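(* Let $G$ be a finite group. If $\mathbb{Z}G$ has a non-trivial bicyclic unit $\alpha$ (that is, $\alpha\neq 1$), then $\mathbb{Z}G$ has bicyclic units $\beta$ and $\gamma$ of different types such that $(\alpha,\beta)$ and $(\alpha,\gamma)$ are free pairs.
   Context: $\mathbb{Z}G$ is the integral group ring of $G$. The bicyclic units of $\mathbb{Z}G$ are the elements of one of the forms $\beta_{x,h}=1+(1-h)x(1+h+h^2+\cdots+h^{d-1})$ (type $\beta$) or $\gamma_{x,h}=1+(1+h+h^2+\cdots+h^{d-1})x(1-h)$ (type $\gamma$), where $x,h\in G$ and $h$ has order $d$. Two bicyclic units are of the same type if both are of type $\beta$ or both are of type $\gamma$; otherwise they are of different types. A pair $(g,h)$ of elements of a group is a free pair if $\langle g,h\rangle$ is a non-abelian free group (free on the two generators $g,h$). *)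

theory Defs
  imports "HOL-Algebra.Multiplicative_Group" "HOL-Algebra.Elementary_Groups"
begin

section \<open>The integral group ring\<close>

text \<open>
  Elements of \<open>\<int>G\<close> are the finitely supported functions \<open>G \<Rightarrow> \<int>\<close>, extended by \<open>0\<close> outside
  the carrier of \<open>G\<close>; multiplication is convolution.
\<close>

definition group_ring :: "('a, 'b) monoid_scheme \<Rightarrow> ('a \<Rightarrow> int) ring" where
  "group_ring G =
    \<lparr> carrier = {a. finite {x. a x \<noteq> 0} \<and> {x. a x \<noteq> 0} \<subseteq> carrier G},
      monoid.mult = (\<lambda>a b z.
        \<Sum>x | a x \<noteq> 0. \<Sum>y | b y \<noteq> 0. if x \<otimes>\<^bsub>G\<^esub> y = z then a x * b y else 0),
      one = (\<lambda>z. if z = \<one>\<^bsub>G\<^esub> then 1 else 0),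
      ring.zero = (\<lambda>z. 0),
      ring.add = (\<lambda>a b z. a z + b z) \<rparr>"

definition group_ring_of :: "'a \<Rightarrow> 'a \<Rightarrow> int" where
  "group_ring_of g = (\<lambda>z. if z = g then 1 else 0)"


section \<open>Bicyclic units\<close>

text \<open>For \<open>h\<close> of (finite) order \<open>d\<close>, the element \<open>1 + h + \<dots> + h\<^sup>d\<^sup>-\<^sup>1\<close> of \<open>\<int>G\<close>.\<close>

definition cyclic_sum :: "('a, 'b) monoid_scheme \<Rightarrow> 'a \<Rightarrow> 'a \<Rightarrow> int" where
  "cyclic_sum G h =
    (\<Oplus>\<^bsub>group_ring G\<^esub> i \<in> {..<group.ord G h}. group_ring_of (h [^]\<^bsub>G\<^esub> (i::nat)))"

definition bicyclic_beta :: "('a, 'b) monoid_scheme \<Rightarrow> 'a \<Rightarrow> 'a \<Rightarrow> 'a \<Rightarrow> int" where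
  "bicyclic_beta G x h =
    \<one>\<^bsub>group_ring G\<^esub> \<oplus>\<^bsub>group_ring G\<^esub>
      (\<one>\<^bsub>group_ring G\<^esub> \<ominus>\<^bsub>group_ring G\<^esub> group_ring_of h)
        \<otimes>\<^bsub>group_ring G\<^esub> group_ring_of x \<otimes>\<^bsub>group_ring G\<^esub> cyclic_sum G h"

definition bicyclic_gamma :: "('a, 'b) monoid_scheme \<Rightarrow> 'a \<Rightarrow> 'a \<Rightarrow> 'a \<Rightarrow> int" where
  "bicyclic_gamma G x h =
    \<one>\<^bsub>group_ring G\<^esub> \<oplus>\<^bsub>group_ring G\<^esub>
      cyclic_sum G h \<otimes>\<^bsub>group_ring G\<^esub> group_ring_of x
        \<otimes>\<^bsub>group_ring G\<^esub> (\<one>\<^bsub>group_ring G\<^esub> \<ominus>\<^bsub>group_ring G\<^esub> group_ring_of h)"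

definition beta_units :: "('a, 'b) monoid_scheme \<Rightarrow> ('a \<Rightarrow> int) set" where
  "beta_units G = {bicyclic_beta G x h | x h. x \<in> carrier G \<and> h \<in> carrier G}"

definition gamma_units :: "('a, 'b) monoid_scheme \<Rightarrow> ('a \<Rightarrow> int) set" where
  "gamma_units G = {bicyclic_gamma G x h | x h. x \<in> carrier G \<and> h \<in> carrier G}"

definition bicyclic_units :: "('a, 'b) monoid_scheme \<Rightarrow> ('a \<Rightarrow> int) set" where
  "bicyclic_units G = beta_units G \<union> gamma_units G"

text \<open>
  The type belongs to the presentation of a bicyclic unit, not just to the underlying ring element:
  the sets \<open>beta_units G\<close> and \<open>gamma_units G\<close> always share \<open>1\<close>, and they can even coincide
  (for instance for the dihedral group of order 8). So two bicyclic units are of different types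
  when one can be written in the form \<open>\<beta>\<close> and the other in the form \<open>\<gamma>\<close>.
\<close>

definition different_types ::
    "('a, 'b) monoid_scheme \<Rightarrow> ('a \<Rightarrow> int) \<Rightarrow> ('a \<Rightarrow> int) \<Rightarrow> bool" where
  "different_types G u v \<longleftrightarrow>
    u \<in> beta_units G \<and> v \<in> gamma_units G \<or> u \<in> gamma_units G \<and> v \<in> beta_units G"


section \<open>Free groups and free pairs\<close>

text \<open>
  A word over \<open>X\<close> is a list of letters; the letter \<open>(x, True)\<close> stands for \<open>x\<close>
  and \<open>(x, False)\<close> for the inverse of \<open>x\<close>.
\<close>

definition word_value :: "('a, 'b) monoid_scheme \<Rightarrow> ('a \<times> bool) list \<Rightarrow> 'a" where
  "word_value F w =
    foldr (\<lambda>(x, s) y. (if s then x else inv\<^bsub>F\<^esub> x) \<otimes>\<^bsub>F\<^esub> y) w \<one>\<^bsub>F\<^esub>"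

definition reduced_word :: "('a \<times> bool) list \<Rightarrow> bool" where
  "reduced_word w \<longleftrightarrow>
    successively (\<lambda>p q. \<not> (fst p = fst q \<and> snd p \<noteq> snd q)) w"

definition free_group_on :: "('a, 'b) monoid_scheme \<Rightarrow> 'a set \<Rightarrow> bool" where
  "free_group_on F X \<longleftrightarrow>
    group F \<and> X \<subseteq> carrier F \<and> generate F X = carrier F \<and>
    (\<forall>w. w \<noteq> [] \<and> set w \<subseteq> X \<times> UNIV \<and> reduced_word w \<longrightarrow> word_value F w \<noteq> \<one>\<^bsub>F\<^esub>)"

text \<open>The condition \<open>g \<noteq> h\<close> makes the free group have rank two, hence be non-abelian.\<close>

definition free_pair :: "('a, 'b) monoid_scheme \<Rightarrow> 'a \<Rightarrow> 'a \<Rightarrow> bool" where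
  "free_pair H g h \<longleftrightarrow>
    g \<in> carrier H \<and> h \<in> carrier H \<and> g \<noteq> h \<and>
    free_group_on (subgroup_generated H {g, h}) {g, h}"

end

theory Submission
  imports Defs "Jordan_Normal_Form.Schur_Decomposition" "Jordan_Normal_Form.Spectral_Radius"
begin

text \<open>
  A bicyclic unit is \<open>1 + a\<close> with \<open>a\<^sup>2 = 0\<close>. Let \<open>a\<close> and \<open>b\<close> both have square zero and let \<open>v\<close> be
  an eigenvector of left multiplication by \<open>ab\<close> on the complex group algebra, with eigenvalue
  \<open>\<mu> \<noteq> 0\<close>. In the basis \<open>v, bv\<close> of the plane they span, \<open>1 + a\<close> and \<open>1 + b\<close> act as the two
  triangular matrices with off-diagonal entries \<open>\<mu>\<close> and \<open>1\<close>. These generate a free group as soon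
  as \<open>\<bar>\<mu>\<bar> \<ge> 4\<close>, by ping-pong (\<open>free_pair_if_transvections\<close>). So it suffices to find \<open>b\<close> for which
  \<open>ab\<close> has an eigenvalue of absolute value at least \<open>4\<close>.

  Large eigenvalues come from the trace. Left multiplication by \<open>c\<close> has trace \<open>\<bar>G\<bar> c(1)\<close>, and if
  \<open>c\<close> is invariant under translation by a subgroup \<open>K\<close> then at most \<open>\<bar>G\<bar> / \<bar>K\<bar>\<close> of its eigenvalues
  are non-zero. Averaging gives an eigenvalue whose real part is at least \<open>\<bar>K\<bar> c(1)\<close>
  (\<open>large_eigenvalue_if_invariant\<close>).

  Let \<open>\<alpha> = \<beta>\<^bsub>x,h\<^esub>\<close>, \<open>H = \<langle>h\<rangle>\<close> and \<open>d = \<bar>H\<bar>\<close>. Then \<open>a\<close> is the indicator function of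
  \<open>xH\<close> minus that of \<open>hxH\<close>. The unit is non-trivial exactly when these cosets differ, that is, when
  \<open>x\<close> does not normalise \<open>H\<close>, and then \<open>d \<ge> 2\<close>. Since \<open>(ab)(1)\<close> is the sum of the
  \<open>a(g) b(g\<^sup>-\<^sup>1)\<close>, it counts overlaps of cosets.

  \<^item> The image of \<open>\<alpha>\<close> under the involution \<open>g \<mapsto> g\<^sup>-\<^sup>1\<close> of the group ring is
    \<open>\<gamma>\<^bsub>x\<^sup>-\<^sup>1,h\<^sup>-\<^sup>1\<^esub>\<close>. For this partner \<open>b(g\<^sup>-\<^sup>1) = a(g)\<close>, and \<open>(ab)(1)\<close> is the sum of the squares
    of the values of \<open>a\<close>, namely \<open>2d \<ge> 4\<close>.

  \<^item> A partner of the same type is \<open>\<beta>\<^bsub>x\<^sup>-\<^sup>1,k\<^esub>\<close> with \<open>k = xhx\<^sup>-\<^sup>1\<close>. Here \<open>g \<mapsto> b(g\<^sup>-\<^sup>1)\<close> is the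
    indicator of the same coset \<open>xH\<close> minus that of \<open>xHk\<^sup>-\<^sup>1\<close>. The set \<open>xH\<close> meets neither \<open>hxH\<close> nor
    \<open>xHk\<^sup>-\<^sup>1\<close>, so \<open>(ab)(1) \<ge> d\<close>. As \<open>b\<close> is right invariant under \<open>\<langle>k\<rangle>\<close>, of order \<open>d\<close>, there is
    an eigenvalue with real part at least \<open>d\<^sup>2 \<ge> 4\<close>.

  Units of type \<open>\<gamma>\<close> are treated in the mirror-symmetric way.
\<close>

section \<open>Eigenvalues and traces of complex matrices\<close>

definition mat_trace :: "'a :: comm_ring_1 mat \<Rightarrow> 'a" where
  "mat_trace A = (\<Sum>i<dim_row A. A $$ (i, i))"

lemma mat_trace_mult_commute:
  fixes A B :: "'a :: comm_ring_1 mat"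
  assumes "A \<in> carrier_mat n m" and "B \<in> carrier_mat m n"
  shows "mat_trace (A * B) = mat_trace (B * A)"
proof -
  have "mat_trace (A * B) = (\<Sum>i<n. \<Sum>j<m. A $$ (i, j) * B $$ (j, i))"
    using assms by (auto simp: mat_trace_def scalar_prod_def atLeast0LessThan intro!: sum.cong)
  also have "\<dots> = (\<Sum>j<m. \<Sum>i<n. B $$ (j, i) * A $$ (i, j))"
    by (subst sum.swap) (simp add: mult.commute)
  also have "\<dots> = mat_trace (B * A)"
    using assms by (auto simp: mat_trace_def scalar_prod_def atLeast0LessThan intro!: sum.cong)
  finally show ?thesis .
qed

text \<open>
  Schur triangularisation: the trace does not change under similarity, and the diagonal of the
  triangular form lists the roots of the characteristic polynomial.
\<close>
lemma mat_trace_eq_sum_eigenvalues: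
  fixes A :: "complex mat"
  assumes A: "A \<in> carrier_mat n n"
  obtains es where "mat_trace A = sum_list es" and "length es = n"
    and "\<And>e. e \<in> set es \<Longrightarrow> eigenvalue A e"
proof -
  obtain es where es: "char_poly A = (\<Prod>e\<leftarrow>es. [:- e, 1:])" "length es = n"
    using char_poly_factorized[OF A] by blast
  obtain B P Q where BPQ: "schur_decomposition A es = (B, P, Q)"
    by (metis prod_cases3)
  from schur_decomposition[OF A es(1) BPQ]
  have sim: "similar_mat_wit A B P Q" and diag: "diag_mat B = es" by auto
  note w = similar_mat_witD2[OF A sim]
  have "mat_trace A = mat_trace (P * (B * Q))"
    using w by (simp add: assoc_mult_mat[of P n n B n Q n])
  also have "\<dots> = mat_trace (B * Q * P)"
    using w by (intro mat_trace_mult_commute[of _ n n]) auto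
  also have "B * Q * P = B"
    using w by (simp add: assoc_mult_mat[of B n n Q n P n])
  also have "mat_trace B = sum_list es"
    unfolding diag[symmetric] diag_mat_def mat_trace_def
    by (simp add: sum_list_sum_nth atLeast0LessThan)
  finally have "mat_trace A = sum_list es" .
  moreover have "eigenvalue A e" if "e \<in> set es" for e
    unfolding eigenvalue_root_char_poly[OF A] es(1) using that
    by (auto simp: poly_prod_list prod_list_zero_iff image_iff intro!: bexI[of _ e])
  ultimately show ?thesis using that es(2) by blast
qed

lemma sum_list_le_const:
  fixes xs :: "real list" and t :: real
  assumes "\<And>x. x \<in> set xs \<Longrightarrow> x \<le> t"
  shows "sum_list xs \<le> length xs * t"
  using assms by (induction xs) (auto simp: algebra_simps, fastforce)

lemma exists_eigenvalue_Re_gt: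
  fixes A :: "complex mat"
  assumes A: "A \<in> carrier_mat n n" and "real n * t < Re (mat_trace A)"
  obtains e where "eigenvalue A e" and "t < Re e"
proof -
  obtain es where es: "mat_trace A = sum_list es" "length es = n"
    "\<And>e. e \<in> set es \<Longrightarrow> eigenvalue A e"
    using mat_trace_eq_sum_eigenvalues[OF A] by blast
  have Re: "Re (sum_list es) = sum_list (map Re es)" by (induction es) auto
  have "\<exists>e\<in>set es. t < Re e"
  proof (rule ccontr)
    assume "\<not> ?thesis"
    then have "sum_list (map Re es) \<le> length (map Re es) * t"
      by - (rule sum_list_le_const, auto simp: not_less)
    then show False using assms(2) es(1,2) Re by simp
  qed
  then show ?thesis using that es(3) by blast
qed

lemma smult_zero_vec [simp]: "c \<cdot>\<^sub>v 0\<^sub>v n = (0\<^sub>v n :: 'a :: mult_zero vec)"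
  by (rule eq_vecI) auto

text \<open>
  Since \<open>A\<close> absorbs \<open>E\<close>, its non-zero eigenvalues live on a space of dimension \<open>tr E\<close>, over which
  the trace of \<open>A\<close> is averaged. Instead of restricting \<open>A\<close> to that space, the proof adds \<open>t (1 - E)\<close>,
  which only moves the eigenvalues outside it, to \<open>t\<close>. If every eigenvalue of \<open>A\<close> had real part at
  most \<open>t < r\<close>, the perturbed matrix would have trace exceeding \<open>n t\<close> and hence an eigenvalue with
  real part above \<open>t\<close>, which is then already an eigenvalue of \<open>A\<close>.
\<close>
lemma exists_eigenvalue_Re_ge:
  fixes A E :: "complex mat"
  assumes A: "A \<in> carrier_mat n n" and E: "E \<in> carrier_mat n n"
    and idem: "E * E = E" and absorb: "A * E = A \<or> E * A = A"
    and trE: "0 < Re (mat_trace E)" and r: "0 < r"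
    and tr: "r * Re (mat_trace E) \<le> Re (mat_trace A)"
  obtains e where "eigenvalue A e" and "r \<le> Re e"
proof -
  have "\<exists>e. eigenvalue A e \<and> r \<le> Re e"
  proof (rule ccontr)
    assume none: "\<not> ?thesis"
    define t where "t = Max (insert 0 (Re ` spectrum A))"
    have fin: "finite (insert 0 (Re ` spectrum A))"
      using card_finite_spectrum(1)[OF A] by simp
    \<comment> \<open>The \<open>0\<close> in the maximum makes \<open>t \<ge> 0\<close>, so an eigenvalue with real part above \<open>t\<close> is neither
    \<open>0\<close> nor \<open>t\<close>; both are excluded below.\<close>
    have t0: "0 \<le> t" unfolding t_def using fin by (intro Max_ge) auto
    have t_ge: "Re e \<le> t" if "eigenvalue A e" for e
      unfolding t_def using fin that by (intro Max_ge) (auto simp: spectrum_def)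
    have t_less: "t < r"
      unfolding t_def using fin none r by (subst Max_less_iff) (auto simp: spectrum_def not_le)
    define F where "F = 1\<^sub>m n - E"
    define B where "B = A + of_real t \<cdot>\<^sub>m F"
    have F: "F \<in> carrier_mat n n" and B: "B \<in> carrier_mat n n"
      using A E by (auto simp: F_def B_def)
    have "Re (mat_trace B) = Re (mat_trace A) + t * (n - Re (mat_trace E))"
    proof -
      have "mat_trace B = (\<Sum>i<n. A $$ (i, i) + of_real t * (1 - E $$ (i, i)))"
        using A E by (auto simp: mat_trace_def B_def F_def intro!: sum.cong)
      also have "\<dots> = mat_trace A + of_real t * (of_nat n - mat_trace E)"
        using A E by (simp add: mat_trace_def sum.distrib sum_subtractf flip: sum_distrib_left)
      finally show ?thesis by simp
    qed
    moreover have "t * Re (mat_trace E) < r * Re (mat_trace E)"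
      using t_less trE by simp
    ultimately have "real n * t < Re (mat_trace B)"
      using tr by (simp add: algebra_simps)
    then obtain e where e: "eigenvalue B e" "t < Re e"
      using exists_eigenvalue_Re_gt[OF B] by blast
    then obtain v where v: "v \<in> carrier_vec n" "v \<noteq> 0\<^sub>v n" and Bv: "B *\<^sub>v v = e \<cdot>\<^sub>v v"
      using B unfolding eigenvalue_def eigenvector_def by auto
    have Bv': "A *\<^sub>v v + of_real t \<cdot>\<^sub>v (F *\<^sub>v v) = e \<cdot>\<^sub>v v"
    proof -
      have "(A + of_real t \<cdot>\<^sub>m F) *\<^sub>v v = A *\<^sub>v v + (of_real t \<cdot>\<^sub>m F) *\<^sub>v v"
        using A F v by (intro add_mult_distrib_mat_vec[of _ n n]) auto
      also have "(of_real t \<cdot>\<^sub>m F) *\<^sub>v v = of_real t \<cdot>\<^sub>v (F *\<^sub>v v)"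
        using F v by (intro eq_vecI) auto
      finally show ?thesis using Bv unfolding B_def by simp
    qed
    have FF: "F * F = F"
    proof -
      have "F * F = F - E * F"
        using minus_mult_distrib_mat[OF one_carrier_mat E F] F unfolding F_def[symmetric] by simp
      also have "E * F = 0\<^sub>m n n"
        using mult_minus_distrib_mat[OF E one_carrier_mat E] E idem unfolding F_def[symmetric] by simp
      finally show ?thesis using F by (intro eq_matI) auto
    qed
    have e_ne: "e \<noteq> of_real t" "e \<noteq> 0" using e(2) t0 by auto
    have kill: "w = 0\<^sub>v n" if w: "w \<in> carrier_vec n" "of_real t \<cdot>\<^sub>v w = e \<cdot>\<^sub>v w" for w
    proof (rule eq_vecI)
      fix i assume i: "i < dim_vec (0\<^sub>v n :: complex vec)"
      have "(of_real t \<cdot>\<^sub>v w) $ i = (e \<cdot>\<^sub>v w) $ i" using w(2) by simp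
      then have "of_real t * w $ i = e * w $ i" using w(1) i by simp
      then show "w $ i = 0\<^sub>v n $ i" using e_ne(1) i by simp
    qed (use w in auto)
    \<comment> \<open>If \<open>A E = A\<close>, then \<open>A v\<close> is an eigenvector of \<open>A\<close>; if \<open>E A = A\<close>, then \<open>v\<close> itself is one.\<close>
    have ev: "eigenvalue A e" using absorb
    proof
      assume AE: "A * E = A"
      have AF: "A * F = 0\<^sub>m n n"
        using mult_minus_distrib_mat[OF A one_carrier_mat E] A AE unfolding F_def by simp
      have "A *\<^sub>v (e \<cdot>\<^sub>v v) = A *\<^sub>v (A *\<^sub>v v) + of_real t \<cdot>\<^sub>v (A *\<^sub>v (F *\<^sub>v v))"
        unfolding Bv'[symmetric] using A F v
        by (subst mult_add_distrib_mat_vec[of _ n n]) (auto simp: mult_mat_vec)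
      also have "A *\<^sub>v (F *\<^sub>v v) = 0\<^sub>v n"
        using A F v by (subst assoc_mult_mat_vec[symmetric, of _ n n _ n]) (auto simp: AF)
      finally have AAv: "A *\<^sub>v (A *\<^sub>v v) = e \<cdot>\<^sub>v (A *\<^sub>v v)"
        using A v by (simp add: mult_mat_vec)
      have "A *\<^sub>v v \<noteq> 0\<^sub>v n"
      proof
        assume z: "A *\<^sub>v v = 0\<^sub>v n"
        have tF: "of_real t \<cdot>\<^sub>v (F *\<^sub>v v) = e \<cdot>\<^sub>v v"
          using Bv' F v unfolding z by auto
        have "of_real t \<cdot>\<^sub>v (F *\<^sub>v v) = of_real t \<cdot>\<^sub>v (F *\<^sub>v (F *\<^sub>v v))"
          using F v by (subst assoc_mult_mat_vec[symmetric, of _ n n _ n]) (auto simp: FF)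
        also have "\<dots> = F *\<^sub>v (of_real t \<cdot>\<^sub>v (F *\<^sub>v v))"
          using F v by (simp add: mult_mat_vec[of _ n n])
        also have "\<dots> = e \<cdot>\<^sub>v (F *\<^sub>v v)"
          unfolding tF using F v by (simp add: mult_mat_vec[of _ n n])
        finally have Fv: "F *\<^sub>v v = 0\<^sub>v n" using F v by (intro kill) auto
        have "0\<^sub>v n = e \<cdot>\<^sub>v v" using tF unfolding Fv by simp
        then have "v = 0\<^sub>v n" using e_ne(2) v
          by (metis smult_smult_assoc one_smult_vec left_inverse smult_zero_vec)
        then show False using v by blast
      qed
      then show ?thesis
        using A v AAv unfolding eigenvalue_def eigenvector_def by (auto intro!: exI[of _ "A *\<^sub>v v"])
    next
      assume EA: "E * A = A"
      have FA: "F * A = 0\<^sub>m n n"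
        using minus_mult_distrib_mat[OF one_carrier_mat E A] A EA unfolding F_def by simp
      have "e \<cdot>\<^sub>v (F *\<^sub>v v) = F *\<^sub>v (e \<cdot>\<^sub>v v)"
        using F v by (simp add: mult_mat_vec[of _ n n])
      also have "\<dots> = F *\<^sub>v (A *\<^sub>v v) + of_real t \<cdot>\<^sub>v (F *\<^sub>v (F *\<^sub>v v))"
        unfolding Bv'[symmetric] using A F v
        by (subst mult_add_distrib_mat_vec[of _ n n]) (auto simp: mult_mat_vec)
      also have "F *\<^sub>v (A *\<^sub>v v) = 0\<^sub>v n"
        using A F v by (subst assoc_mult_mat_vec[symmetric, of _ n n _ n]) (auto simp: FA)
      also have "F *\<^sub>v (F *\<^sub>v v) = F *\<^sub>v v"
        using F v by (subst assoc_mult_mat_vec[symmetric, of _ n n _ n]) (auto simp: FF)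
      finally have "of_real t \<cdot>\<^sub>v (F *\<^sub>v v) = e \<cdot>\<^sub>v (F *\<^sub>v v)" using F v by simp
      then have Fv: "F *\<^sub>v v = 0\<^sub>v n" using F v by (intro kill) auto
      have "A *\<^sub>v v = e \<cdot>\<^sub>v v" using Bv' A v unfolding Fv by simp
      then show ?thesis using A v unfolding eigenvalue_def eigenvector_def by auto
    qed
    then show False using t_ge[OF ev] e(2) by simp
  qed
  then show ?thesis using that by blast
qed

section \<open>A ping-pong criterion for free pairs\<close>

lemma word_value_Cons:
  "word_value F ((x, s) # w) = (if s then x else inv\<^bsub>F\<^esub> x) \<otimes>\<^bsub>F\<^esub> word_value F w"
  by (simp add: word_value_def)

lemma (in group) word_value_closed:
  assumes "set w \<subseteq> carrier G \<times> UNIV"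
  shows "word_value G w \<in> carrier G"
  using assms by (induction w) (auto simp: word_value_def)

lemma (in group) word_value_subgroup_generated:
  assumes "set w \<subseteq> carrier (subgroup_generated G S) \<times> UNIV"
  shows "word_value (subgroup_generated G S) w = word_value G w"
  using assms
proof (induction w)
  case (Cons p w)
  then show ?case
    by (cases p) (auto simp: word_value_Cons)
qed (simp add: word_value_def)

lemma (in group) free_group_on_subgroup_generated:
  assumes X: "X \<subseteq> carrier G"
    and free: "\<And>w. w \<noteq> [] \<Longrightarrow> set w \<subseteq> X \<times> UNIV \<Longrightarrow> reduced_word w \<Longrightarrow> word_value G w \<noteq> \<one>"
  shows "free_group_on (subgroup_generated G X) X"
proof -
  have X': "X \<subseteq> carrier (subgroup_generated G X)"
    using X by (auto simp: carrier_subgroup_generated intro: generate.incl)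
  have "generate (subgroup_generated G X) X = carrier (subgroup_generated (subgroup_generated G X) X)"
    using X' by (simp add: carrier_subgroup_generated Int_absorb1 del: subgroup_generated2)
  then have "generate (subgroup_generated G X) X = carrier (subgroup_generated G X)"
    by simp
  moreover have "word_value (subgroup_generated G X) w \<noteq> \<one>"
    if "w \<noteq> []" "set w \<subseteq> X \<times> UNIV" "reduced_word w" for w
  proof -
    have "set w \<subseteq> carrier (subgroup_generated G X) \<times> UNIV" using that(2) X' by auto
    from word_value_subgroup_generated[OF this] free[OF that] show ?thesis by simp
  qed
  ultimately show ?thesis
    using X' by (simp add: free_group_on_def)
qed

lemma free_pair_commute: "free_pair H g h \<longleftrightarrow> free_pair H h g"
  by (auto simp: free_pair_def insert_commute)

definition sgn_of :: "bool \<Rightarrow> complex" where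
  "sgn_of s = (if s then 1 else -1)"

lemma reduced_word_Cons:
  "reduced_word (p # w) \<longleftrightarrow>
    reduced_word w \<and> (w \<noteq> [] \<longrightarrow> \<not> (fst p = fst (hd w) \<and> snd p \<noteq> snd (hd w)))"
  by (cases w) (auto simp: reduced_word_def)

text \<open>
  The two ping-pong sets are \<open>\<bar>p\<bar> < 2 \<bar>q\<bar>\<close> and \<open>2 \<bar>q\<bar> < \<bar>p\<bar>\<close>. The factor \<open>2\<close> balances the off-diagonal
  entries \<open>\<mu>\<close> and \<open>1\<close>: after rescaling \<open>q\<close> by it, they become \<open>\<mu> / 2\<close> and \<open>2\<close>, of absolute value at
  least \<open>2\<close>, as for Sanov's matrices.
\<close>
lemma norm_add_large_multiple:
  fixes p q \<mu> :: complex
  assumes "4 \<le> norm \<mu>" "0 < n" "norm p < 2 * norm q"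
  shows "2 * norm q < norm (p + sgn_of s * of_nat n * \<mu> * q)"
proof -
  have "4 * norm q \<le> (real n * norm \<mu>) * norm q"
  proof (intro mult_right_mono)
    have "1 * 4 \<le> real n * norm \<mu>" using assms by (intro mult_mono) auto
    then show "4 \<le> real n * norm \<mu>" by simp
  qed auto
  also have "\<dots> = norm (sgn_of s * of_nat n * \<mu> * q)"
    by (simp add: norm_mult sgn_of_def)
  also have "\<dots> \<le> norm (p + sgn_of s * of_nat n * \<mu> * q) + norm p"
    by (metis add_diff_cancel_left' norm_triangle_sub add.commute norm_minus_commute norm_triangle_ineq4)
  finally show ?thesis using assms(3) by linarith
qed

lemma norm_add_multiple:
  fixes p q :: complex
  assumes "0 < n" "2 * norm q < norm p"
  shows "norm p < 2 * norm (q + sgn_of s * of_nat n * p)"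
proof -
  have "norm p \<le> real n * norm p" using assms(1) by (simp add: mult_le_cancel_right1)
  also have "\<dots> = norm (sgn_of s * of_nat n * p)"
    by (simp add: norm_mult sgn_of_def)
  also have "\<dots> \<le> norm (q + sgn_of s * of_nat n * p) + norm q"
    by (metis add_diff_cancel_left' norm_triangle_ineq4)
  finally show ?thesis using assms(2) by linarith
qed

text \<open>
  The map \<open>S\<close> gives coordinates on a plane of vectors. Non-zero powers of \<open>g\<close> map \<open>\<bar>p\<bar> < 2 \<bar>q\<bar>\<close> into
  \<open>2 \<bar>q\<bar> < \<bar>p\<bar>\<close>, and those of \<open>h\<close> do the opposite. Each such step also increases the height
  \<open>max \<bar>p\<bar> (2 \<bar>q\<bar>)\<close>, so a reduced word moves a suitable starting vector whatever its first and last
  letters are.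
\<close>
lemma (in group) free_pair_if_transvections:
  fixes act :: "'a \<Rightarrow> 'v \<Rightarrow> 'v" and S :: "complex \<Rightarrow> complex \<Rightarrow> 'v" and \<mu> :: complex
  assumes g: "g \<in> carrier G" and h: "h \<in> carrier G"
    and act_one: "\<And>p q. act \<one> (S p q) = S p q"
    and act_mult: "\<And>x y p q. x \<in> carrier G \<Longrightarrow> y \<in> carrier G \<Longrightarrow>
      act (x \<otimes> y) (S p q) = act x (act y (S p q))"
    and act_g: "\<And>p q. act g (S p q) = S (p + \<mu> * q) q"
    and act_h: "\<And>p q. act h (S p q) = S p (q + p)"
    and S_inj: "\<And>p q p' q'. S p q = S p' q' \<Longrightarrow> p = p' \<and> q = q'"
    and \<mu>: "4 \<le> norm \<mu>"
  shows "free_pair G g h"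
proof -
  have inv_g: "act (inv g) (S p q) = S (p - \<mu> * q) q" for p q
    using act_mult[of "inv g" g "p - \<mu> * q" q] g by (simp add: act_g act_one)
  have inv_h: "act (inv h) (S p q) = S p (q - p)" for p q
    using act_mult[of "inv h" h p "q - p"] h by (simp add: act_h act_one)
  have g_ne_h: "g \<noteq> h"
    using act_g[of 1 0] act_h[of 1 0] S_inj[of 1 0 1 1] by auto
  have step_g: "act (if s then g else inv g) (S p q) = S (p + sgn_of s * \<mu> * q) q" for s p q
    by (simp add: act_g inv_g sgn_of_def)
  have step_h: "act (if s then h else inv h) (S p q) = S p (q + sgn_of s * p)" for s p q
    by (simp add: act_h inv_h sgn_of_def)
  have wv_step: "act (word_value G ((x, s) # w)) (S p q)
      = act (if s then x else inv x) (act (word_value G w) (S p q))"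
    if "set ((x, s) # w) \<subseteq> {g, h} \<times> UNIV" for x s w p q
    unfolding word_value_Cons using that g h
    by (intro act_mult word_value_closed) auto
  \<comment> \<open>The starting vector lies in the ping-pong set on which the last letter, which acts first, expands;
  \<open>level\<close> is its height.\<close>
  define start where "start x = (if x = g then (0, 1) else (1, 0) :: complex \<times> complex)" for x
  define level :: "'a \<Rightarrow> real" where "level x = (if x = g then 2 else 1)" for x
  \<comment> \<open>The word acts on the starting vector as its leading syllable, the \<open>n\<close>-th power of its first
  letter, applied to a vector in the ping-pong set on which that syllable expands.\<close>
  have main: "\<exists>n p q. 0 < n \<and>
      (fst (hd w) = g \<longrightarrow>
        act (word_value G w) (case_prod S (start (fst (last w))))
          = S (p + sgn_of (snd (hd w)) * of_nat n * \<mu> * q) q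
        \<and> norm p < 2 * norm q \<and> level (fst (last w)) \<le> 2 * norm q) \<and>
      (fst (hd w) = h \<longrightarrow>
        act (word_value G w) (case_prod S (start (fst (last w))))
          = S p (q + sgn_of (snd (hd w)) * of_nat n * p)
        \<and> 2 * norm q < norm p \<and> level (fst (last w)) \<le> norm p)"
    (is "\<exists>n p q. ?Q w n p q")
    if "w \<noteq> []" "set w \<subseteq> {g, h} \<times> UNIV" "reduced_word w" for w
    using that
  proof (induction w)
    case (Cons l w)
    obtain x s where l: "l = (x, s)" by (cases l)
    have x: "x = g \<or> x = h" using Cons.prems(2) l by auto
    note wv = wv_step[OF Cons.prems(2)[unfolded l]]
    show ?case
    proof (cases "w = []")
      case True
      have one: "act (word_value G []) (S p q) = S p q" for p q
        by (simp add: word_value_def act_one)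
      show ?thesis using x
      proof
        assume "x = g"
        then show ?thesis using True l g_ne_h step_g[of s 0 1] wv[of 0 1]
          by (intro exI[of _ "1::nat"] exI[of _ 0] exI[of _ 1])
            (auto simp: start_def level_def True one)
      next
        assume "x = h"
        then show ?thesis using True l g_ne_h step_h[of s 1 0] wv[of 1 0]
          by (intro exI[of _ "1::nat"] exI[of _ 1] exI[of _ 0])
            (auto simp: start_def level_def True one)
      qed
    next
      case False
      obtain y t w' where w: "w = (y, t) # w'" using False by (cases w) auto
      have y: "y = g \<or> y = h" using Cons.prems(2) w by auto
      have red: "reduced_word w" and comp: "x = y \<Longrightarrow> s = t"
        using Cons.prems(3) l w by (auto simp: reduced_word_Cons)
      have "set w \<subseteq> {g, h} \<times> UNIV" using Cons.prems(2) by simp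
      from Cons.IH[OF False this red] obtain n p q where n: "0 < n"
        and G: "y = g \<Longrightarrow> act (word_value G w) (case_prod S (start (fst (last w))))
          = S (p + sgn_of t * of_nat n * \<mu> * q) q
          \<and> norm p < 2 * norm q \<and> level (fst (last w)) \<le> 2 * norm q"
        and H: "y = h \<Longrightarrow> act (word_value G w) (case_prod S (start (fst (last w))))
          = S p (q + sgn_of t * of_nat n * p)
          \<and> 2 * norm q < norm p \<and> level (fst (last w)) \<le> norm p"
        unfolding w by auto
      have act_lw: "act (word_value G (l # w)) (case_prod S (start (fst (last (l # w)))))
        = act (if s then x else inv x) (act (word_value G w) (case_prod S (start (fst (last w)))))"
        using wv False l by (simp add: case_prod_beta)
      consider "x = g" "y = g" | "x = g" "y = h" | "x = h" "y = g" | "x = h" "y = h"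
        using x y by blast
      then show ?thesis
      proof cases
        case 1
        have "act (if s then g else inv g) (S (p + sgn_of s * of_nat n * \<mu> * q) q)
          = S (p + sgn_of s * of_nat (Suc n) * \<mu> * q) q"
          by (subst step_g) (simp add: algebra_simps)
        then have "?Q (l # w) (Suc n) p q"
          unfolding act_lw using 1 G comp False l g_ne_h by auto
        then show ?thesis by blast
      next
        case 2
        define q' where "q' = q + sgn_of t * of_nat n * p"
        have "norm p < 2 * norm q'"
          unfolding q'_def using norm_add_multiple n H 2 by blast
        then have "?Q (l # w) 1 p q'"
          unfolding act_lw using 2 H False l g_ne_h step_g[of s p q'] by (cases s) (auto simp: q'_def)
        then show ?thesis by blast
      next
        case 3
        define p' where "p' = p + sgn_of t * of_nat n * \<mu> * q"
        have "2 * norm q < norm p'"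
          unfolding p'_def using norm_add_large_multiple \<mu> n G 3 by blast
        then have "?Q (l # w) 1 p' q"
          unfolding act_lw using 3 G False l g_ne_h step_h[of s p' q] by (cases s) (auto simp: p'_def)
        then show ?thesis by blast
      next
        case 4
        have "act (if s then h else inv h) (S p (q + sgn_of s * of_nat n * p))
          = S p (q + sgn_of s * of_nat (Suc n) * p)"
          by (subst step_h) (simp add: algebra_simps)
        then have "?Q (l # w) (Suc n) p q"
          unfolding act_lw using 4 H comp False l g_ne_h by auto
        then show ?thesis by blast
      qed
    qed
  qed simp
  have "word_value G w \<noteq> \<one>"
    if w: "w \<noteq> []" "set w \<subseteq> {g, h} \<times> UNIV" "reduced_word w" for w
  proof
    assume triv: "word_value G w = \<one>"
    obtain n p q where Q: "?Q w n p q" using main[OF w] by blast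
    have hd: "fst (hd w) = g \<or> fst (hd w) = h" using w(1,2) by (cases w) auto
    have start_act: "act (word_value G w) (case_prod S (start (fst (last w)))) = case_prod S (start (fst (last w)))"
      unfolding triv by (simp add: act_one case_prod_beta)
    obtain p' q' where pq': "start (fst (last w)) = (p', q')" by fastforce
    then have lev: "max (norm p') (2 * norm q') = level (fst (last w))"
      by (auto simp: start_def level_def split: if_splits)
    from hd show False
    proof
      assume A: "fst (hd w) = g"
      define p'' where "p'' = p + sgn_of (snd (hd w)) * of_nat n * \<mu> * q"
      have "S p'' q = S p' q'" using A Q start_act pq' p''_def by simp
      then have "p'' = p'" using S_inj by blast
      moreover have "2 * norm q < norm p''"
        unfolding p''_def using norm_add_large_multiple \<mu> Q A by blast
      ultimately show False using lev A Q by auto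
    next
      assume A: "fst (hd w) = h"
      define q'' where "q'' = q + sgn_of (snd (hd w)) * of_nat n * p"
      have "S p q'' = S p' q'" using A Q start_act pq' q''_def by simp
      then have "q'' = q'" using S_inj by blast
      moreover have "norm p < 2 * norm q''"
        unfolding q''_def using norm_add_multiple Q A by blast
      ultimately show False using lev A Q by auto
    qed
  qed
  then show ?thesis
    unfolding free_pair_def using g h g_ne_h
    by (auto intro!: free_group_on_subgroup_generated)
qed

section \<open>The group ring of a finite group\<close>

lemma (in group) mult_cancel [simp]:
  "x \<in> carrier G \<Longrightarrow> y \<in> carrier G \<Longrightarrow> x \<otimes> (inv x \<otimes> y) = y"
  "x \<in> carrier G \<Longrightarrow> y \<in> carrier G \<Longrightarrow> inv x \<otimes> (x \<otimes> y) = y"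
  by (simp_all flip: m_assoc)

lemma (in ring) sandwich_square_zero:
  assumes "u \<in> carrier R" "x \<in> carrier R" "w \<in> carrier R" and wu: "w \<otimes> u = \<zero>"
  shows "(u \<otimes> x \<otimes> w) \<otimes> (u \<otimes> x \<otimes> w) = \<zero>"
proof -
  have "(u \<otimes> x \<otimes> w) \<otimes> (u \<otimes> x \<otimes> w) = u \<otimes> x \<otimes> (w \<otimes> u) \<otimes> (x \<otimes> w)"
    using assms(1-3) by (simp add: m_assoc)
  then show ?thesis using assms by simp
qed

text \<open>
  With \<open>G\<close> finite, convolution can be written as a sum over the whole carrier, and \<open>\<int>G\<close> acts on a
  space of finite dimension.
\<close>
locale finite_group = group G for G (structure) +
  assumes finite_carrier: "finite (carrier G)"
begin

abbreviation "ZG \<equiv> group_ring G"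

lemma group_ring_carrier_iff: "a \<in> carrier ZG \<longleftrightarrow> (\<forall>z. z \<notin> carrier G \<longrightarrow> a z = 0)"
  using finite_carrier by (auto simp: group_ring_def intro: finite_subset[of _ "carrier G"])

lemma group_ring_eqI:
  assumes "a \<in> carrier ZG" "b \<in> carrier ZG" "\<And>z. z \<in> carrier G \<Longrightarrow> a z = b z"
  shows "a = b"
  using assms by (auto simp: group_ring_carrier_iff fun_eq_iff) metis

lemma group_ring_add_apply [simp]: "(a \<oplus>\<^bsub>ZG\<^esub> b) z = a z + b z"
  by (simp add: group_ring_def)

lemma group_ring_zero_apply [simp]: "\<zero>\<^bsub>ZG\<^esub> z = 0"
  by (simp add: group_ring_def)

lemma group_ring_one_apply: "\<one>\<^bsub>ZG\<^esub> z = (if z = \<one> then 1 else 0)"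
  by (simp add: group_ring_def)

lemma group_ring_mult_apply:
  assumes a: "a \<in> carrier ZG" and b: "b \<in> carrier ZG" and z: "z \<in> carrier G"
  shows "(a \<otimes>\<^bsub>ZG\<^esub> b) z = (\<Sum>x\<in>carrier G. a x * b (inv x \<otimes> z))"
proof -
  have eq: "x \<otimes> y = z \<longleftrightarrow> y = inv x \<otimes> z" if "x \<in> carrier G" "y \<in> carrier G" for x y
    using that z by (metis inv_solve_left)
  have "(a \<otimes>\<^bsub>ZG\<^esub> b) z = (\<Sum>x | a x \<noteq> 0. \<Sum>y | b y \<noteq> 0. if x \<otimes> y = z then a x * b y else 0)"
    by (simp add: group_ring_def)
  also have "\<dots> = (\<Sum>x\<in>carrier G. \<Sum>y\<in>carrier G. if x \<otimes> y = z then a x * b y else 0)"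
  proof (rule sum.mono_neutral_cong_left)
    fix x
    show "(\<Sum>y | b y \<noteq> 0. if x \<otimes> y = z then a x * b y else 0)
        = (\<Sum>y\<in>carrier G. if x \<otimes> y = z then a x * b y else 0)"
      using b finite_carrier by (intro sum.mono_neutral_left) (auto simp: group_ring_carrier_iff)
  next
    show "\<forall>x\<in>carrier G - {x. a x \<noteq> 0}. (\<Sum>y\<in>carrier G. if x \<otimes> y = z then a x * b y else 0) = 0"
      by (intro ballI sum.neutral) auto
  qed (use a finite_carrier in \<open>auto simp: group_ring_carrier_iff\<close>)
  also have "\<dots> = (\<Sum>x\<in>carrier G. a x * b (inv x \<otimes> z))"
  proof (intro sum.cong refl)
    fix x assume x: "x \<in> carrier G"
    have "(\<Sum>y\<in>carrier G. if x \<otimes> y = z then a x * b y else 0)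
        = (\<Sum>y\<in>carrier G. if y = inv x \<otimes> z then a x * b y else 0)"
      using x by (intro sum.cong) (auto simp: eq)
    also have "\<dots> = a x * b (inv x \<otimes> z)"
      using x z finite_carrier by (simp add: sum.delta)
    finally show "(\<Sum>y\<in>carrier G. if x \<otimes> y = z then a x * b y else 0) = a x * b (inv x \<otimes> z)" .
  qed
  finally show ?thesis .
qed

lemma group_ring_mult_closed:
  assumes "a \<in> carrier ZG" "b \<in> carrier ZG"
  shows "a \<otimes>\<^bsub>ZG\<^esub> b \<in> carrier ZG"
proof -
  have "(a \<otimes>\<^bsub>ZG\<^esub> b) z = 0" if "z \<notin> carrier G" for z
  proof -
    have "x \<otimes> y \<noteq> z" if "a x \<noteq> 0" "b y \<noteq> 0" for x y
      using assms that \<open>z \<notin> carrier G\<close> unfolding group_ring_carrier_iff by (metis m_closed)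
    then show ?thesis by (auto simp: group_ring_def intro!: sum.neutral)
  qed
  then show ?thesis by (simp add: group_ring_carrier_iff)
qed

lemma sum_carrier_translate:
  assumes "g \<in> carrier G"
  shows "(\<Sum>x\<in>carrier G. f (g \<otimes> x)) = (\<Sum>x\<in>carrier G. f x)"
    and "(\<Sum>x\<in>carrier G. f (x \<otimes> g)) = (\<Sum>x\<in>carrier G. f x)"
proof -
  show "(\<Sum>x\<in>carrier G. f (g \<otimes> x)) = (\<Sum>x\<in>carrier G. f x)"
    using assms
    by (intro sum.reindex_bij_witness[of _ "\<lambda>x. inv g \<otimes> x" "\<lambda>x. g \<otimes> x"])
      (auto simp flip: m_assoc)
  show "(\<Sum>x\<in>carrier G. f (x \<otimes> g)) = (\<Sum>x\<in>carrier G. f x)"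
    using assms
    by (intro sum.reindex_bij_witness[of _ "\<lambda>x. x \<otimes> inv g" "\<lambda>x. x \<otimes> g"])
      (auto simp: m_assoc)
qed

lemma group_ring_mult_assoc:
  assumes a: "a \<in> carrier ZG" and b: "b \<in> carrier ZG" and c: "c \<in> carrier ZG"
  shows "(a \<otimes>\<^bsub>ZG\<^esub> b) \<otimes>\<^bsub>ZG\<^esub> c = a \<otimes>\<^bsub>ZG\<^esub> (b \<otimes>\<^bsub>ZG\<^esub> c)"
proof (rule group_ring_eqI)
  fix z assume z: "z \<in> carrier G"
  have "((a \<otimes>\<^bsub>ZG\<^esub> b) \<otimes>\<^bsub>ZG\<^esub> c) z
      = (\<Sum>x\<in>carrier G. \<Sum>y\<in>carrier G. a y * (b (inv y \<otimes> x) * c (inv x \<otimes> z)))"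
    using assms z by (simp add: group_ring_mult_apply group_ring_mult_closed
        sum_distrib_right mult.assoc)
  also have "\<dots> = (\<Sum>y\<in>carrier G. \<Sum>x\<in>carrier G. a y * (b (inv y \<otimes> x) * c (inv x \<otimes> z)))"
    by (rule sum.swap)
  also have "\<dots> = (\<Sum>y\<in>carrier G. a y * (b \<otimes>\<^bsub>ZG\<^esub> c) (inv y \<otimes> z))"
  proof (intro sum.cong refl)
    fix y assume y: "y \<in> carrier G"
    have "(\<Sum>x\<in>carrier G. a y * (b (inv y \<otimes> x) * c (inv x \<otimes> z)))
        = (\<Sum>x\<in>carrier G. a y * (b (inv y \<otimes> (y \<otimes> x)) * c (inv (y \<otimes> x) \<otimes> z)))"
      using sum_carrier_translate(1)[OF y, symmetric] .
    also have "\<dots> = (\<Sum>x\<in>carrier G. a y * (b x * c (inv x \<otimes> (inv y \<otimes> z))))"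
      using y z by (intro sum.cong refl) (simp add: inv_mult_group m_assoc flip: m_assoc[of "inv y" y])
    also have "\<dots> = a y * (b \<otimes>\<^bsub>ZG\<^esub> c) (inv y \<otimes> z)"
      using y z b c by (simp add: group_ring_mult_apply sum_distrib_left)
    finally show "(\<Sum>x\<in>carrier G. a y * (b (inv y \<otimes> x) * c (inv x \<otimes> z)))
        = a y * (b \<otimes>\<^bsub>ZG\<^esub> c) (inv y \<otimes> z)" .
  qed
  also have "\<dots> = (a \<otimes>\<^bsub>ZG\<^esub> (b \<otimes>\<^bsub>ZG\<^esub> c)) z"
    using assms z by (simp add: group_ring_mult_apply group_ring_mult_closed)
  finally show "((a \<otimes>\<^bsub>ZG\<^esub> b) \<otimes>\<^bsub>ZG\<^esub> c) z = (a \<otimes>\<^bsub>ZG\<^esub> (b \<otimes>\<^bsub>ZG\<^esub> c)) z" .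
qed (use assms group_ring_mult_closed in auto)

lemma group_ring_of_closed [simp]: "g \<in> carrier G \<Longrightarrow> group_ring_of g \<in> carrier ZG"
  by (auto simp: group_ring_carrier_iff group_ring_of_def)

lemma one_eq_group_ring_of: "\<one>\<^bsub>ZG\<^esub> = group_ring_of \<one>"
  by (auto simp: group_ring_of_def group_ring_one_apply)

lemma group_ring_of_mult_apply:
  assumes g: "g \<in> carrier G" and b: "b \<in> carrier ZG" and z: "z \<in> carrier G"
  shows "(group_ring_of g \<otimes>\<^bsub>ZG\<^esub> b) z = b (inv g \<otimes> z)"
proof -
  have "(group_ring_of g \<otimes>\<^bsub>ZG\<^esub> b) z
      = (\<Sum>x\<in>carrier G. if x = g then b (inv x \<otimes> z) else 0)"
    using assms by (simp add: group_ring_mult_apply) (auto simp: group_ring_of_def intro!: sum.cong)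
  then show ?thesis using g finite_carrier by (simp add: sum.delta)
qed

lemma mult_group_ring_of_apply:
  assumes g: "g \<in> carrier G" and a: "a \<in> carrier ZG" and z: "z \<in> carrier G"
  shows "(a \<otimes>\<^bsub>ZG\<^esub> group_ring_of g) z = a (z \<otimes> inv g)"
proof -
  have eq: "inv x \<otimes> z = g \<longleftrightarrow> x = z \<otimes> inv g" if "x \<in> carrier G" for x
    using that g z by (metis inv_closed inv_inv inv_solve_left inv_solve_right m_closed)
  have "(a \<otimes>\<^bsub>ZG\<^esub> group_ring_of g) z
      = (\<Sum>x\<in>carrier G. if x = z \<otimes> inv g then a x else 0)"
    using assms by (simp add: group_ring_mult_apply) (auto simp: group_ring_of_def eq intro!: sum.cong)
  then show ?thesis using g z finite_carrier by (simp add: sum.delta)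
qed

lemma ring_group_ring: "ring ZG"
proof (rule ringI)
  show "abelian_group ZG"
  proof (rule abelian_groupI)
    fix a assume "a \<in> carrier ZG"
    then show "\<exists>b\<in>carrier ZG. b \<oplus>\<^bsub>ZG\<^esub> a = \<zero>\<^bsub>ZG\<^esub>"
      by (intro bexI[of _ "\<lambda>z. - a z"]) (auto simp: group_ring_carrier_iff fun_eq_iff)
  qed (auto simp: group_ring_carrier_iff fun_eq_iff)
  show "Group.monoid ZG"
  proof (rule monoidI)
    fix a assume a: "a \<in> carrier ZG"
    show "\<one>\<^bsub>ZG\<^esub> \<otimes>\<^bsub>ZG\<^esub> a = a"
      unfolding one_eq_group_ring_of using a
      by (intro group_ring_eqI) (auto simp: group_ring_of_mult_apply group_ring_mult_closed)
    show "a \<otimes>\<^bsub>ZG\<^esub> \<one>\<^bsub>ZG\<^esub> = a"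
      unfolding one_eq_group_ring_of using a
      by (intro group_ring_eqI) (auto simp: mult_group_ring_of_apply group_ring_mult_closed)
  qed (auto simp: group_ring_mult_closed group_ring_mult_assoc one_eq_group_ring_of)
  fix a b c assume abc: "a \<in> carrier ZG" "b \<in> carrier ZG" "c \<in> carrier ZG"
  have add: "u \<oplus>\<^bsub>ZG\<^esub> v \<in> carrier ZG" if "u \<in> carrier ZG" "v \<in> carrier ZG" for u v
    using that by (auto simp: group_ring_carrier_iff)
  show "(a \<oplus>\<^bsub>ZG\<^esub> b) \<otimes>\<^bsub>ZG\<^esub> c = a \<otimes>\<^bsub>ZG\<^esub> c \<oplus>\<^bsub>ZG\<^esub> b \<otimes>\<^bsub>ZG\<^esub> c"
    using abc by (intro group_ring_eqI)
      (auto simp: add group_ring_mult_closed group_ring_mult_apply distrib_right sum.distrib)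
  show "c \<otimes>\<^bsub>ZG\<^esub> (a \<oplus>\<^bsub>ZG\<^esub> b) = c \<otimes>\<^bsub>ZG\<^esub> a \<oplus>\<^bsub>ZG\<^esub> c \<otimes>\<^bsub>ZG\<^esub> b"
    using abc by (intro group_ring_eqI)
      (auto simp: add group_ring_mult_closed group_ring_mult_apply distrib_left sum.distrib)
qed

sublocale ZG: ring "group_ring G" by (rule ring_group_ring)

lemma group_ring_minus_apply:
  assumes "a \<in> carrier ZG" "b \<in> carrier ZG"
  shows "(a \<ominus>\<^bsub>ZG\<^esub> b) z = a z - b z"
proof -
  have "\<ominus>\<^bsub>ZG\<^esub> b = (\<lambda>z. - b z)"
    using assms by (intro ZG.minus_equality) (auto simp: group_ring_carrier_iff fun_eq_iff)
  then show ?thesis by (simp add: ZG.minus_eq)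
qed

lemma group_ring_finsum_apply:
  assumes "finite I" and "\<And>i. i \<in> I \<Longrightarrow> f i \<in> carrier ZG"
  shows "(\<Oplus>\<^bsub>ZG\<^esub>i\<in>I. f i) z = (\<Sum>i\<in>I. f i z)"
  using assms by (induction I) auto

lemma cyclic_sum_apply:
  assumes h: "h \<in> carrier G"
  shows "cyclic_sum G h z = of_bool (z \<in> generate G {h})"
proof -
  have ord: "{0..ord h - 1} = {..<ord h}"
  proof -
    have "finite (generate G {h})" and "generate G {h} \<noteq> {}"
      using h finite_carrier generate_incl[of "{h}"] generate.one by (auto intro: finite_subset)
    then have "0 < ord h" using generate_pow_card[OF h] by (simp add: card_gt_0_iff)
    then show ?thesis by auto
  qed
  have gen: "generate G {h} = (\<lambda>i. h [^] i) ` {..<ord h}"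
    using ord_elems[OF finite_carrier h] generate_pow_on_finite_carrier[OF finite_carrier h]
    unfolding ord by auto
  have inj: "inj_on (\<lambda>i. h [^] (i::nat)) {..<ord h}"
    using ord_inj[OF h] unfolding ord .
  have "cyclic_sum G h z = (\<Sum>i<ord h. group_ring_of (h [^] i) z)"
    unfolding cyclic_sum_def using h by (intro group_ring_finsum_apply) auto
  also have "\<dots> = (\<Sum>y\<in>generate G {h}. group_ring_of y z)"
    unfolding gen using inj by (simp add: sum.reindex)
  also have "\<dots> = of_bool (z \<in> generate G {h})"
    using gen by (simp add: group_ring_of_def sum.delta)
  finally show ?thesis .
qed

section \<open>The regular representation\<close>

definition enum :: "nat \<Rightarrow> 'a" where
  "enum = (SOME e. bij_betw e {..<card (carrier G)} (carrier G))"

lemma enum_bij: "bij_betw enum {..<card (carrier G)} (carrier G)"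
  unfolding enum_def
  using ex_bij_betw_nat_finite[OF finite_carrier] unfolding atLeast0LessThan by (rule someI_ex)

lemma enum_closed [simp]: "i < card (carrier G) \<Longrightarrow> enum i \<in> carrier G"
  using enum_bij by (auto simp: bij_betw_def)

text \<open>
  The matrix of left multiplication by \<open>a\<close> on the complex group algebra in the basis \<open>G\<close>: the
  coefficient of \<open>g\<close> in \<open>a g'\<close> is \<open>a (g g'\<^sup>-\<^sup>1)\<close>.
\<close>
definition reg :: "('a \<Rightarrow> int) \<Rightarrow> complex mat" where
  "reg a = mat (card (carrier G)) (card (carrier G)) (\<lambda>(i, j). of_int (a (enum i \<otimes> inv (enum j))))"

lemma reg_carrier [simp]: "reg a \<in> carrier_mat (card (carrier G)) (card (carrier G))"
  by (simp add: reg_def)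

lemma reg_mult:
  assumes a: "a \<in> carrier ZG" and b: "b \<in> carrier ZG"
  shows "reg (a \<otimes>\<^bsub>ZG\<^esub> b) = reg a * reg b"
proof (rule eq_matI)
  let ?n = "card (carrier G)"
  fix i j assume "i < dim_row (reg a * reg b)" and "j < dim_col (reg a * reg b)"
  then have i: "i < ?n" and j: "j < ?n" by (simp_all add: reg_def)
  have "(reg a * reg b) $$ (i, j) = (\<Sum>k<?n. of_int (a (enum i \<otimes> inv (enum k)) * b (enum k \<otimes> inv (enum j))))"
    using i j by (simp add: reg_def scalar_prod_def atLeast0LessThan)
  also have "\<dots> = (\<Sum>y\<in>carrier G. of_int (a (enum i \<otimes> inv y) * b (y \<otimes> inv (enum j))))"
    by (rule sum.reindex_bij_betw[OF enum_bij])
  also have "\<dots> = of_int (\<Sum>x\<in>carrier G. a x * b (inv x \<otimes> (enum i \<otimes> inv (enum j))))"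
    unfolding of_int_sum using i j
    by (intro sum.reindex_bij_witness[of _ "\<lambda>x. inv x \<otimes> enum i" "\<lambda>y. enum i \<otimes> inv y"])
      (auto simp: inv_mult_group m_assoc)
  also have "\<dots> = reg (a \<otimes>\<^bsub>ZG\<^esub> b) $$ (i, j)"
    using i j a b by (simp add: reg_def group_ring_mult_apply)
  finally show "reg (a \<otimes>\<^bsub>ZG\<^esub> b) $$ (i, j) = (reg a * reg b) $$ (i, j)" ..
qed (simp_all add: reg_def)

lemma reg_add: "reg (a \<oplus>\<^bsub>ZG\<^esub> b) = reg a + reg b"
  by (rule eq_matI) (auto simp: reg_def)

lemma reg_zero: "reg \<zero>\<^bsub>ZG\<^esub> = 0\<^sub>m (card (carrier G)) (card (carrier G))"
  by (rule eq_matI) (auto simp: reg_def)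

lemma mat_trace_reg: "mat_trace (reg a) = of_nat (card (carrier G)) * of_int (a \<one>)"
  by (simp add: mat_trace_def reg_def)

lemma reg_one: "reg \<one>\<^bsub>ZG\<^esub> = 1\<^sub>m (card (carrier G))"
proof (rule eq_matI)
  fix i j assume "i < dim_row (1\<^sub>m (card (carrier G)) :: complex mat)"
    "j < dim_col (1\<^sub>m (card (carrier G)) :: complex mat)"
  then have ij: "i < card (carrier G)" "j < card (carrier G)" by simp_all
  have "enum i \<otimes> inv (enum j) = \<one> \<longleftrightarrow> enum i = enum j"
    using ij by (metis enum_closed inv_equality inv_closed inv_inv r_inv)
  also have "\<dots> \<longleftrightarrow> i = j"
    using ij enum_bij by (auto simp: bij_betw_def inj_on_def)
  finally show "reg \<one>\<^bsub>ZG\<^esub> $$ (i, j) = 1\<^sub>m (card (carrier G)) $$ (i, j)"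
    using ij by (simp add: reg_def group_ring_one_apply)
qed (simp_all add: reg_def)

text \<open>
  The inverse of \<open>1 + a\<close> is \<open>1 - a\<close>.
\<close>
lemma one_plus_square_zero_in_Units:
  assumes a: "a \<in> carrier ZG" and sq: "a \<otimes>\<^bsub>ZG\<^esub> a = \<zero>\<^bsub>ZG\<^esub>"
  shows "\<one>\<^bsub>ZG\<^esub> \<oplus>\<^bsub>ZG\<^esub> a \<in> Units ZG"
proof -
  have "(\<one>\<^bsub>ZG\<^esub> \<oplus>\<^bsub>ZG\<^esub> a) \<otimes>\<^bsub>ZG\<^esub> (\<one>\<^bsub>ZG\<^esub> \<ominus>\<^bsub>ZG\<^esub> a) = \<one>\<^bsub>ZG\<^esub>"
    "(\<one>\<^bsub>ZG\<^esub> \<ominus>\<^bsub>ZG\<^esub> a) \<otimes>\<^bsub>ZG\<^esub> (\<one>\<^bsub>ZG\<^esub> \<oplus>\<^bsub>ZG\<^esub> a) = \<one>\<^bsub>ZG\<^esub>"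
    using a sq by (simp_all add: ZG.minus_eq ZG.l_distr ZG.r_distr ZG.l_minus ZG.r_minus
        ZG.a_assoc ZG.l_neg ZG.r_neg)
  then show ?thesis unfolding Units_def using a by auto
qed

text \<open>
  For an eigenvector \<open>v\<close> of \<open>ab\<close>, the plane spanned by \<open>v\<close> and \<open>u = bv\<close> is stable, because
  \<open>au = \<mu> v\<close>, while \<open>av = 0\<close> and \<open>bu = 0\<close> follow from \<open>a\<^sup>2 = b\<^sup>2 = 0\<close>.
\<close>
lemma free_pair_if_large_eigenvalue:
  assumes a: "a \<in> carrier ZG" and b: "b \<in> carrier ZG"
    and aa: "a \<otimes>\<^bsub>ZG\<^esub> a = \<zero>\<^bsub>ZG\<^esub>" and bb: "b \<otimes>\<^bsub>ZG\<^esub> b = \<zero>\<^bsub>ZG\<^esub>"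
    and ev: "eigenvalue (reg (a \<otimes>\<^bsub>ZG\<^esub> b)) \<mu>" and \<mu>: "4 \<le> norm \<mu>"
  shows "free_pair (units_of ZG) (\<one>\<^bsub>ZG\<^esub> \<oplus>\<^bsub>ZG\<^esub> a) (\<one>\<^bsub>ZG\<^esub> \<oplus>\<^bsub>ZG\<^esub> b)"
proof -
  define n where "n = card (carrier G)"
  have regc: "reg c \<in> carrier_mat n n" for c by (simp add: n_def)
  obtain v where v: "v \<in> carrier_vec n" "v \<noteq> 0\<^sub>v n"
    and abv: "reg (a \<otimes>\<^bsub>ZG\<^esub> b) *\<^sub>v v = \<mu> \<cdot>\<^sub>v v"
    using ev regc[of "a \<otimes>\<^bsub>ZG\<^esub> b"] unfolding eigenvalue_def eigenvector_def by auto
  have \<mu>0: "\<mu> \<noteq> 0" using \<mu> by auto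
  define u where "u = reg b *\<^sub>v v"
  have u: "u \<in> carrier_vec n" unfolding u_def by (rule mult_mat_vec_carrier[OF regc v(1)])
  have smult_eq_0: "w = 0\<^sub>v n" if "w \<in> carrier_vec n" "\<mu> \<cdot>\<^sub>v w = 0\<^sub>v n" for w
    using that \<mu>0 by (metis smult_smult_assoc one_smult_vec left_inverse smult_zero_vec)
  have comp: "reg (c \<otimes>\<^bsub>ZG\<^esub> d) *\<^sub>v w = reg c *\<^sub>v (reg d *\<^sub>v w)"
    if "c \<in> carrier ZG" "d \<in> carrier ZG" "w \<in> carrier_vec n" for c d w
    using that by (simp add: reg_mult assoc_mult_mat_vec[OF regc regc])
  have au: "reg a *\<^sub>v u = \<mu> \<cdot>\<^sub>v v"
    unfolding u_def using comp[OF a b v(1)] abv by simp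
  have av: "reg a *\<^sub>v v = 0\<^sub>v n"
  proof (rule smult_eq_0)
    have "\<mu> \<cdot>\<^sub>v (reg a *\<^sub>v v) = reg a *\<^sub>v (reg a *\<^sub>v u)"
      unfolding au using regc v by (simp add: mult_mat_vec[of _ n n])
    also have "\<dots> = reg (a \<otimes>\<^bsub>ZG\<^esub> a) *\<^sub>v u" by (rule comp[OF a a u, symmetric])
    also have "\<dots> = 0\<^sub>v n" unfolding aa reg_zero n_def[symmetric] using u by auto
    finally show "\<mu> \<cdot>\<^sub>v (reg a *\<^sub>v v) = 0\<^sub>v n" .
  qed (rule mult_mat_vec_carrier[OF regc v(1)])
  have bu: "reg b *\<^sub>v u = 0\<^sub>v n"
    unfolding u_def comp[OF b b v(1), symmetric] bb reg_zero n_def[symmetric] using v by auto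
  define S where "S p q = p \<cdot>\<^sub>v v + q \<cdot>\<^sub>v u" for p q
  have S: "S p q \<in> carrier_vec n" for p q unfolding S_def using u v by simp
  have reg_S: "reg c *\<^sub>v S p q = p \<cdot>\<^sub>v (reg c *\<^sub>v v) + q \<cdot>\<^sub>v (reg c *\<^sub>v u)" for c p q
    unfolding S_def using regc u v
    by (subst mult_add_distrib_mat_vec[of _ n n]) (auto simp: mult_mat_vec[of _ n n])
  have one_plus: "reg (\<one>\<^bsub>ZG\<^esub> \<oplus>\<^bsub>ZG\<^esub> c) *\<^sub>v w = w + reg c *\<^sub>v w" if "w \<in> carrier_vec n" for c w
    unfolding reg_add reg_one n_def[symmetric] using regc that
    by (subst add_mult_distrib_mat_vec[of _ n n]) auto
  have S_inj: "p = p' \<and> q = q'" if eq: "S p q = S p' q'" for p q p' q'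
  proof -
    obtain i where i: "i < n" "v $ i \<noteq> 0"
      using v by (metis carrier_vecD eq_vecI index_zero_vec)
    have "q \<cdot>\<^sub>v (\<mu> \<cdot>\<^sub>v v) = q' \<cdot>\<^sub>v (\<mu> \<cdot>\<^sub>v v)"
      using arg_cong[OF eq, of "\<lambda>w. reg a *\<^sub>v w"] v unfolding reg_S av au by simp
    from arg_cong[OF this, of "\<lambda>w. w $ i"] have q: "q = q'" using i v \<mu>0 by simp
    from arg_cong[OF eq, of "\<lambda>w. w $ i"] have "p = p'"
      unfolding S_def q using i v u by simp
    with q show ?thesis by simp
  qed
  interpret U: group "units_of ZG" by (rule ZG.units_group)
  show ?thesis
  proof (rule U.free_pair_if_transvections[where act = "\<lambda>x w. reg x *\<^sub>v w" and S = S and \<mu> = \<mu>])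
    show "\<one>\<^bsub>ZG\<^esub> \<oplus>\<^bsub>ZG\<^esub> a \<in> carrier (units_of ZG)" "\<one>\<^bsub>ZG\<^esub> \<oplus>\<^bsub>ZG\<^esub> b \<in> carrier (units_of ZG)"
      using a b aa bb by (simp_all add: units_of_carrier one_plus_square_zero_in_Units)
    fix p q
    show "reg \<one>\<^bsub>units_of ZG\<^esub> *\<^sub>v S p q = S p q"
      using S by (simp add: units_of_one reg_one n_def)
    show "reg (\<one>\<^bsub>ZG\<^esub> \<oplus>\<^bsub>ZG\<^esub> a) *\<^sub>v S p q = S (p + \<mu> * q) q"
      using u v by (subst one_plus[OF S], unfold reg_S av au, unfold S_def, intro eq_vecI) (auto simp: algebra_simps)
    show "reg (\<one>\<^bsub>ZG\<^esub> \<oplus>\<^bsub>ZG\<^esub> b) *\<^sub>v S p q = S p (q + p)"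
      using u v
      by (subst one_plus[OF S], unfold reg_S bu u_def[symmetric], unfold S_def, intro eq_vecI) (auto simp: algebra_simps)
  next
    fix x y p q assume "x \<in> carrier (units_of ZG)" "y \<in> carrier (units_of ZG)"
    then show "reg (x \<otimes>\<^bsub>units_of ZG\<^esub> y) *\<^sub>v S p q = reg x *\<^sub>v (reg y *\<^sub>v S p q)"
      using S by (simp add: units_of_mult units_of_carrier comp ZG.Units_closed)
  qed (use S_inj \<mu> in auto)
qed


section \<open>Free pairs from a large trace\<close>

definition subgroup_sum :: "'a set \<Rightarrow> 'a \<Rightarrow> int" where
  "subgroup_sum K = (\<lambda>z. of_bool (z \<in> K))"

lemma subgroup_sum_closed: "subgroup K G \<Longrightarrow> subgroup_sum K \<in> carrier ZG"
  using subgroup.subset by (fastforce simp: subgroup_sum_def group_ring_carrier_iff)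

definition right_invariant :: "'a set \<Rightarrow> ('a \<Rightarrow> int) \<Rightarrow> bool" where
  "right_invariant K c \<longleftrightarrow> (\<forall>z\<in>carrier G. \<forall>k\<in>K. c (z \<otimes> k) = c z)"

definition left_invariant :: "'a set \<Rightarrow> ('a \<Rightarrow> int) \<Rightarrow> bool" where
  "left_invariant K c \<longleftrightarrow> (\<forall>z\<in>carrier G. \<forall>k\<in>K. c (k \<otimes> z) = c z)"

text \<open>
  Each element of \<open>K\<close> fixes \<open>c\<close>, and the element \<open>subgroup_sum K\<close> adds up \<open>\<bar>K\<bar>\<close> of them. In particular
  \<open>subgroup_sum K / \<bar>K\<bar>\<close> is an idempotent absorbed by \<open>c\<close>.
\<close>
lemma mult_subgroup_sum:
  assumes K: "subgroup K G" and c: "c \<in> carrier ZG"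
  shows "right_invariant K c \<Longrightarrow> c \<otimes>\<^bsub>ZG\<^esub> subgroup_sum K = (\<lambda>z. int (card K) * c z)"
    and "left_invariant K c \<Longrightarrow> subgroup_sum K \<otimes>\<^bsub>ZG\<^esub> c = (\<lambda>z. int (card K) * c z)"
proof -
  interpret K: subgroup K G by (rule K)
  have cl: "(\<lambda>z. int (card K) * c z) \<in> carrier ZG"
    using c by (simp add: group_ring_carrier_iff)
  have sumK: "(\<Sum>y\<in>carrier G. f y * of_bool (y \<in> K)) = (\<Sum>y\<in>K. f y)" for f :: "'a \<Rightarrow> int"
    using K.subset finite_carrier by (intro sum.mono_neutral_cong_right) auto
  show "c \<otimes>\<^bsub>ZG\<^esub> subgroup_sum K = (\<lambda>z. int (card K) * c z)" if inv: "right_invariant K c"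
  proof (rule group_ring_eqI)
    fix z assume z: "z \<in> carrier G"
    have "(c \<otimes>\<^bsub>ZG\<^esub> subgroup_sum K) z = (\<Sum>x\<in>carrier G. c x * of_bool (inv x \<otimes> z \<in> K))"
      using c subgroup_sum_closed[OF K] z by (simp add: group_ring_mult_apply subgroup_sum_def)
    also have "\<dots> = (\<Sum>y\<in>carrier G. c (z \<otimes> inv y) * of_bool (y \<in> K))"
      using z by (intro sum.reindex_bij_witness[of _ "\<lambda>y. z \<otimes> inv y" "\<lambda>x. inv x \<otimes> z"])
        (auto simp: inv_mult_group m_assoc)
    also have "\<dots> = (\<Sum>y\<in>K. c (z \<otimes> inv y))" by (rule sumK)
    also have "\<dots> = (\<Sum>y\<in>K. c z)"
      using inv z by (intro sum.cong) (auto simp: right_invariant_def)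
    finally show "(c \<otimes>\<^bsub>ZG\<^esub> subgroup_sum K) z = int (card K) * c z" by simp
  qed (use c cl subgroup_sum_closed[OF K] in auto)
  show "subgroup_sum K \<otimes>\<^bsub>ZG\<^esub> c = (\<lambda>z. int (card K) * c z)" if inv: "left_invariant K c"
  proof (rule group_ring_eqI)
    fix z assume z: "z \<in> carrier G"
    have "(subgroup_sum K \<otimes>\<^bsub>ZG\<^esub> c) z = (\<Sum>x\<in>carrier G. c (inv x \<otimes> z) * of_bool (x \<in> K))"
      using c subgroup_sum_closed[OF K] z
      by (simp add: group_ring_mult_apply) (simp add: subgroup_sum_def mult.commute)
    also have "\<dots> = (\<Sum>y\<in>K. c (inv y \<otimes> z))" by (rule sumK)
    also have "\<dots> = (\<Sum>y\<in>K. c z)"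
      using inv z by (intro sum.cong) (auto simp: left_invariant_def)
    finally show "(subgroup_sum K \<otimes>\<^bsub>ZG\<^esub> c) z = int (card K) * c z" by simp
  qed (use c cl subgroup_sum_closed[OF K] in auto)
qed

lemma reg_scale: "reg (\<lambda>z. m * c z) = of_int m \<cdot>\<^sub>m reg c"
  by (rule eq_matI) (auto simp: reg_def)

text \<open>
  The matrix \<open>E\<close> of the idempotent \<open>subgroup_sum K / \<bar>K\<bar>\<close> has trace \<open>\<bar>G\<bar> / \<bar>K\<bar>\<close>, whereas that of \<open>c\<close> is
  \<open>\<bar>G\<bar> c(1)\<close>; the bound is the quotient of the two.
\<close>
lemma large_eigenvalue_if_invariant:
  assumes K: "subgroup K G" and c: "c \<in> carrier ZG"
    and inv: "right_invariant K c \<or> left_invariant K c" and pos: "0 < c \<one>"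
  obtains \<mu> where "eigenvalue (reg c) \<mu>" and "int (card K) * c \<one> \<le> Re \<mu>"
proof -
  interpret K: subgroup K G by (rule K)
  define n where "n = card (carrier G)"
  have regc: "reg c \<in> carrier_mat n n" for c by (simp add: n_def)
  have "finite K" using K.subset finite_carrier by (rule finite_subset)
  then have d: "0 < card K" using K.one_closed by (metis card_gt_0_iff empty_iff)
  have n: "0 < n" unfolding n_def using finite_carrier one_closed by (auto simp: card_gt_0_iff)
  define w where "w = subgroup_sum K"
  have w: "w \<in> carrier ZG" unfolding w_def by (rule subgroup_sum_closed[OF K])
  define E where "E = (1 / of_nat (card K)) \<cdot>\<^sub>m reg w"
  have E: "E \<in> carrier_mat n n" unfolding E_def using regc by simp
  have cancel: "(1 / of_nat (card K) :: complex) \<cdot>\<^sub>m reg (\<lambda>z. int (card K) * f z) = reg f" for f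
    unfolding reg_scale using d by (intro eq_matI) (auto simp: reg_def)
  have "right_invariant K w"
    by (auto simp: right_invariant_def w_def subgroup_sum_def)
      (metis K.mem_carrier K.m_closed K.m_inv_closed inv_solve_right)
  then have ww: "w \<otimes>\<^bsub>ZG\<^esub> w = (\<lambda>z. int (card K) * w z)"
    using mult_subgroup_sum(1)[OF K w] by (simp add: w_def)
  have right: "reg f * E = reg f"
    if "f \<in> carrier ZG" "f \<otimes>\<^bsub>ZG\<^esub> w = (\<lambda>z. int (card K) * f z)" for f
  proof -
    have "reg f * E = (1 / of_nat (card K)) \<cdot>\<^sub>m reg (f \<otimes>\<^bsub>ZG\<^esub> w)"
      unfolding E_def using that(1) w by (simp add: reg_mult mult_smult_distrib[OF regc regc])
    then show ?thesis unfolding that(2) cancel .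
  qed
  have left: "E * reg f = reg f"
    if "f \<in> carrier ZG" "w \<otimes>\<^bsub>ZG\<^esub> f = (\<lambda>z. int (card K) * f z)" for f
  proof -
    have "E * reg f = (1 / of_nat (card K)) \<cdot>\<^sub>m reg (w \<otimes>\<^bsub>ZG\<^esub> f)"
      unfolding E_def using that(1) w by (simp add: reg_mult mult_smult_assoc_mat[OF regc regc])
    then show ?thesis unfolding that(2) cancel .
  qed
  have "E * E = (1 / of_nat (card K)) \<cdot>\<^sub>m (reg w * E)"
    unfolding E_def by (rule mult_smult_assoc_mat[OF regc]) (use E E_def in simp)
  then have idem: "E * E = E" unfolding right[OF w ww] by (simp only: E_def[symmetric])
  have absorb: "reg c * E = reg c \<or> E * reg c = reg c"
    using inv
  proof
    assume "right_invariant K c"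
    from mult_subgroup_sum(1)[OF K c this] show ?thesis using right[OF c] by (simp add: w_def)
  next
    assume "left_invariant K c"
    from mult_subgroup_sum(2)[OF K c this] show ?thesis using left[OF c] by (simp add: w_def)
  qed
  have "mat_trace E = (1 / of_nat (card K)) * mat_trace (reg w)"
    unfolding mat_trace_def sum_distrib_left E_def using regc[of w] by (auto intro!: sum.cong)
  also have "mat_trace (reg w) = of_nat n"
    unfolding mat_trace_reg n_def by (simp add: w_def subgroup_sum_def K.one_closed)
  finally have trE: "Re (mat_trace E) = n / card K" by (simp add: Re_divide_of_nat)
  show ?thesis
  proof (rule exists_eigenvalue_Re_ge[OF regc[of c] E idem absorb])
    show "0 < Re (mat_trace E)" unfolding trE using n d by simp
    show "0 < real_of_int (int (card K) * c \<one>)" using d pos by simp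
    show "real_of_int (int (card K) * c \<one>) * Re (mat_trace E) \<le> Re (mat_trace (reg c))"
      unfolding trE mat_trace_reg n_def[symmetric] using d by simp
  qed (use that in auto)
qed

lemma right_invariant_mult:
  assumes "subgroup K G" "a \<in> carrier ZG" "b \<in> carrier ZG" "right_invariant K b"
  shows "right_invariant K (a \<otimes>\<^bsub>ZG\<^esub> b)"
  unfolding right_invariant_def
proof (intro ballI)
  fix z k assume z: "z \<in> carrier G" and k: "k \<in> K"
  have k': "k \<in> carrier G" using assms(1) k by (rule subgroup.mem_carrier)
  show "(a \<otimes>\<^bsub>ZG\<^esub> b) (z \<otimes> k) = (a \<otimes>\<^bsub>ZG\<^esub> b) z"
    using assms z k k' by (simp add: group_ring_mult_apply right_invariant_def flip: m_assoc)
qed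

lemma left_invariant_mult:
  assumes "subgroup K G" "a \<in> carrier ZG" "b \<in> carrier ZG" "left_invariant K a"
  shows "left_invariant K (a \<otimes>\<^bsub>ZG\<^esub> b)"
  unfolding left_invariant_def
proof (intro ballI)
  fix z k assume z: "z \<in> carrier G" and k: "k \<in> K"
  have k': "k \<in> carrier G" using assms(1) k by (rule subgroup.mem_carrier)
  have "(a \<otimes>\<^bsub>ZG\<^esub> b) (k \<otimes> z) = (\<Sum>x\<in>carrier G. a x * b (inv x \<otimes> (k \<otimes> z)))"
    using assms z k' by (simp add: group_ring_mult_apply)
  also have "\<dots> = (\<Sum>x\<in>carrier G. a (k \<otimes> x) * b (inv (k \<otimes> x) \<otimes> (k \<otimes> z)))"
    by (rule sum_carrier_translate(1)[OF k', symmetric])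
  also have "\<dots> = (\<Sum>x\<in>carrier G. a x * b (inv x \<otimes> z))"
    using assms(4) z k k' by (intro sum.cong) (auto simp: left_invariant_def inv_mult_group m_assoc)
  also have "\<dots> = (a \<otimes>\<^bsub>ZG\<^esub> b) z"
    using assms z by (simp add: group_ring_mult_apply)
  finally show "(a \<otimes>\<^bsub>ZG\<^esub> b) (k \<otimes> z) = (a \<otimes>\<^bsub>ZG\<^esub> b) z" .
qed

lemma group_ring_mult_at_one:
  assumes "a \<in> carrier ZG" "b \<in> carrier ZG"
  shows "(a \<otimes>\<^bsub>ZG\<^esub> b) \<one> = (\<Sum>x\<in>carrier G. a x * b (inv x))"
  using assms by (simp add: group_ring_mult_apply)

lemma free_pair_if_large_trace:
  assumes a: "a \<in> carrier ZG" and b: "b \<in> carrier ZG"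
    and aa: "a \<otimes>\<^bsub>ZG\<^esub> a = \<zero>\<^bsub>ZG\<^esub>" and bb: "b \<otimes>\<^bsub>ZG\<^esub> b = \<zero>\<^bsub>ZG\<^esub>"
    and K: "subgroup K G" and inv: "right_invariant K b \<or> left_invariant K a"
    and tr: "4 \<le> int (card K) * (\<Sum>x\<in>carrier G. a x * b (inv x))"
  shows "free_pair (units_of ZG) (\<one>\<^bsub>ZG\<^esub> \<oplus>\<^bsub>ZG\<^esub> a) (\<one>\<^bsub>ZG\<^esub> \<oplus>\<^bsub>ZG\<^esub> b)"
proof -
  define c where "c = a \<otimes>\<^bsub>ZG\<^esub> b"
  have c: "c \<in> carrier ZG" unfolding c_def using a b by simp
  have tr': "4 \<le> int (card K) * c \<one>" using tr a b by (simp add: c_def group_ring_mult_at_one)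
  then have pos: "0 < c \<one>" by (smt (verit) of_nat_0_le_iff mult_nonneg_nonpos)
  have "right_invariant K c \<or> left_invariant K c"
    unfolding c_def using inv right_invariant_mult[OF K a b] left_invariant_mult[OF K a b] by blast
  then obtain \<mu> where \<mu>: "eigenvalue (reg c) \<mu>" "int (card K) * c \<one> \<le> Re \<mu>"
    using large_eigenvalue_if_invariant[OF K c _ pos] by blast
  have "4 \<le> real_of_int (int (card K) * c \<one>)" using tr' by linarith
  also have "\<dots> \<le> norm \<mu>" using \<mu>(2) complex_Re_le_cmod[of \<mu>] by linarith
  finally show ?thesis
    using free_pair_if_large_eigenvalue[OF a b aa bb] \<mu>(1) unfolding c_def by blast
qed

section \<open>Traces of products of bicyclic units\<close>

lemma subgroup_generate: "h \<in> carrier G \<Longrightarrow> subgroup (generate G {h}) G"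
  by (rule generate_is_subgroup) simp

lemma mem_generate_self: "h \<in> generate G {h}"
  by (simp add: generate.incl)

lemma cyclic_sum_closed: "h \<in> carrier G \<Longrightarrow> cyclic_sum G h \<in> carrier ZG"
  using subgroup.subset[OF subgroup_generate]
  by (auto simp: cyclic_sum_apply group_ring_carrier_iff)

lemma subgroup_mem_mult_iff:
  assumes "subgroup H G" "l \<in> H" "y \<in> carrier G"
  shows "l \<otimes> y \<in> H \<longleftrightarrow> y \<in> H" and "y \<otimes> l \<in> H \<longleftrightarrow> y \<in> H"
proof -
  interpret H: subgroup H G by (rule assms(1))
  show "l \<otimes> y \<in> H \<longleftrightarrow> y \<in> H"
    using assms by (metis H.m_closed H.m_inv_closed H.mem_carrier mult_cancel(2))
  show "y \<otimes> l \<in> H \<longleftrightarrow> y \<in> H"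
    using assms by (metis H.m_closed H.m_inv_closed H.mem_carrier inv_solve_right m_closed)
qed

lemma subgroup_inv_mem_iff:
  assumes "subgroup H G" "y \<in> carrier G"
  shows "inv y \<in> H \<longleftrightarrow> y \<in> H"
  using assms by (metis inv_inv subgroup.m_inv_closed)

text \<open>
  The elements of square zero by which bicyclic units differ from \<open>1\<close>.
\<close>
definition beta_part :: "'a \<Rightarrow> 'a \<Rightarrow> 'a \<Rightarrow> int" where
  "beta_part x h = (\<one>\<^bsub>ZG\<^esub> \<ominus>\<^bsub>ZG\<^esub> group_ring_of h) \<otimes>\<^bsub>ZG\<^esub> group_ring_of x \<otimes>\<^bsub>ZG\<^esub> cyclic_sum G h"

definition gamma_part :: "'a \<Rightarrow> 'a \<Rightarrow> 'a \<Rightarrow> int" where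
  "gamma_part x h = cyclic_sum G h \<otimes>\<^bsub>ZG\<^esub> group_ring_of x \<otimes>\<^bsub>ZG\<^esub> (\<one>\<^bsub>ZG\<^esub> \<ominus>\<^bsub>ZG\<^esub> group_ring_of h)"

lemma bicyclic_eq:
  "bicyclic_beta G x h = \<one>\<^bsub>ZG\<^esub> \<oplus>\<^bsub>ZG\<^esub> beta_part x h"
  "bicyclic_gamma G x h = \<one>\<^bsub>ZG\<^esub> \<oplus>\<^bsub>ZG\<^esub> gamma_part x h"
  by (simp_all add: bicyclic_beta_def bicyclic_gamma_def beta_part_def gamma_part_def)

lemma part_closed [simp]:
  assumes "x \<in> carrier G" "h \<in> carrier G"
  shows "beta_part x h \<in> carrier ZG" "gamma_part x h \<in> carrier ZG"
  using assms by (simp_all add: beta_part_def gamma_part_def cyclic_sum_closed)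

lemma one_minus_mult:
  assumes h: "h \<in> carrier G" and b: "b \<in> carrier ZG" and z: "z \<in> carrier G"
  shows "((\<one>\<^bsub>ZG\<^esub> \<ominus>\<^bsub>ZG\<^esub> group_ring_of h) \<otimes>\<^bsub>ZG\<^esub> b) z = b z - b (inv h \<otimes> z)"
    and "(b \<otimes>\<^bsub>ZG\<^esub> (\<one>\<^bsub>ZG\<^esub> \<ominus>\<^bsub>ZG\<^esub> group_ring_of h)) z = b z - b (z \<otimes> inv h)"
proof -
  have "(\<one>\<^bsub>ZG\<^esub> \<ominus>\<^bsub>ZG\<^esub> group_ring_of h) \<otimes>\<^bsub>ZG\<^esub> b = b \<ominus>\<^bsub>ZG\<^esub> group_ring_of h \<otimes>\<^bsub>ZG\<^esub> b"
    using h b by (simp add: ZG.minus_eq ZG.l_distr ZG.l_minus)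
  then show "((\<one>\<^bsub>ZG\<^esub> \<ominus>\<^bsub>ZG\<^esub> group_ring_of h) \<otimes>\<^bsub>ZG\<^esub> b) z = b z - b (inv h \<otimes> z)"
    using assms by (simp add: group_ring_minus_apply group_ring_of_mult_apply)
  have "b \<otimes>\<^bsub>ZG\<^esub> (\<one>\<^bsub>ZG\<^esub> \<ominus>\<^bsub>ZG\<^esub> group_ring_of h) = b \<ominus>\<^bsub>ZG\<^esub> b \<otimes>\<^bsub>ZG\<^esub> group_ring_of h"
    using h b by (simp add: ZG.minus_eq ZG.r_distr ZG.r_minus)
  then show "(b \<otimes>\<^bsub>ZG\<^esub> (\<one>\<^bsub>ZG\<^esub> \<ominus>\<^bsub>ZG\<^esub> group_ring_of h)) z = b z - b (z \<otimes> inv h)"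
    using assms by (simp add: group_ring_minus_apply mult_group_ring_of_apply)
qed

lemma beta_part_apply:
  assumes "x \<in> carrier G" "h \<in> carrier G" "z \<in> carrier G"
  shows "beta_part x h z = of_bool (inv x \<otimes> z \<in> generate G {h})
    - of_bool (inv x \<otimes> (inv h \<otimes> z) \<in> generate G {h})"
  unfolding beta_part_def using assms
  by (simp add: ZG.m_assoc cyclic_sum_closed one_minus_mult group_ring_of_mult_apply cyclic_sum_apply)

lemma gamma_part_apply:
  assumes "x \<in> carrier G" "h \<in> carrier G" "z \<in> carrier G"
  shows "gamma_part x h z = of_bool (z \<otimes> inv x \<in> generate G {h})
    - of_bool (z \<otimes> inv h \<otimes> inv x \<in> generate G {h})"
  unfolding gamma_part_def using assms
  by (simp add: cyclic_sum_closed one_minus_mult mult_group_ring_of_apply cyclic_sum_apply)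

text \<open>
  Both products contain \<open>1 - h\<close> next to the sum over \<open>\<langle>h\<rangle>\<close>, which annihilate each other.
\<close>
lemma part_square_zero:
  assumes x: "x \<in> carrier G" and h: "h \<in> carrier G"
  shows "beta_part x h \<otimes>\<^bsub>ZG\<^esub> beta_part x h = \<zero>\<^bsub>ZG\<^esub>"
    and "gamma_part x h \<otimes>\<^bsub>ZG\<^esub> gamma_part x h = \<zero>\<^bsub>ZG\<^esub>"
proof -
  note H = subgroup_generate[OF h]
  have inv_h: "inv h \<in> generate G {h}"
    using H mem_generate_self by (rule subgroup.m_inv_closed)
  have "cyclic_sum G h \<otimes>\<^bsub>ZG\<^esub> (\<one>\<^bsub>ZG\<^esub> \<ominus>\<^bsub>ZG\<^esub> group_ring_of h) = \<zero>\<^bsub>ZG\<^esub>"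
    using h by (intro group_ring_eqI)
      (simp_all add: cyclic_sum_closed one_minus_mult cyclic_sum_apply subgroup_mem_mult_iff[OF H inv_h])
  then show "beta_part x h \<otimes>\<^bsub>ZG\<^esub> beta_part x h = \<zero>\<^bsub>ZG\<^esub>"
    unfolding beta_part_def using x h by (intro ZG.sandwich_square_zero) (simp_all add: cyclic_sum_closed)
  have "(\<one>\<^bsub>ZG\<^esub> \<ominus>\<^bsub>ZG\<^esub> group_ring_of h) \<otimes>\<^bsub>ZG\<^esub> cyclic_sum G h = \<zero>\<^bsub>ZG\<^esub>"
    using h by (intro group_ring_eqI)
      (simp_all add: cyclic_sum_closed one_minus_mult cyclic_sum_apply subgroup_mem_mult_iff[OF H inv_h])
  then show "gamma_part x h \<otimes>\<^bsub>ZG\<^esub> gamma_part x h = \<zero>\<^bsub>ZG\<^esub>"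
    unfolding gamma_part_def using x h by (intro ZG.sandwich_square_zero) (simp_all add: cyclic_sum_closed)
qed

lemma part_invariant:
  assumes x: "x \<in> carrier G" and h: "h \<in> carrier G"
  shows "right_invariant (generate G {h}) (beta_part x h)"
    and "left_invariant (generate G {h}) (gamma_part x h)"
proof -
  note H = subgroup_generate[OF h]
  have "beta_part x h (z \<otimes> k) = beta_part x h z \<and> gamma_part x h (k \<otimes> z) = gamma_part x h z"
    if z: "z \<in> carrier G" and k: "k \<in> generate G {h}" for z k
  proof -
    have k': "k \<in> carrier G" using H k by (rule subgroup.mem_carrier)
    show ?thesis
      using subgroup_mem_mult_iff[OF H k, of "inv x \<otimes> z"]
        subgroup_mem_mult_iff[OF H k, of "inv x \<otimes> (inv h \<otimes> z)"]
        subgroup_mem_mult_iff[OF H k, of "z \<otimes> inv x"]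
        subgroup_mem_mult_iff[OF H k, of "z \<otimes> (inv h \<otimes> inv x)"] x h z k'
      by (simp add: beta_part_apply gamma_part_apply m_assoc)
  qed
  then show "right_invariant (generate G {h}) (beta_part x h)"
    "left_invariant (generate G {h}) (gamma_part x h)"
    by (simp_all add: right_invariant_def left_invariant_def)
qed

lemma generate_conjugate:
  assumes x: "x \<in> carrier G" and h: "h \<in> carrier G"
  shows "generate G {x \<otimes> h \<otimes> inv x} = (\<lambda>y. x \<otimes> y \<otimes> inv x) ` generate G {h}"
proof -
  have pow: "(x \<otimes> h \<otimes> inv x) [^] (i::nat) = x \<otimes> h [^] i \<otimes> inv x" for i
    using x h by (induction i) (simp_all add: m_assoc)
  have k: "x \<otimes> h \<otimes> inv x \<in> carrier G" using x h by simp
  show ?thesis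
    unfolding generate_pow_on_finite_carrier[OF finite_carrier h]
      generate_pow_on_finite_carrier[OF finite_carrier k] pow by auto
qed

lemma mem_generate_conjugate_iff:
  assumes x: "x \<in> carrier G" and h: "h \<in> carrier G" and w: "w \<in> carrier G"
  shows "w \<in> generate G {x \<otimes> h \<otimes> inv x} \<longleftrightarrow> inv x \<otimes> w \<otimes> x \<in> generate G {h}"
proof
  assume "w \<in> generate G {x \<otimes> h \<otimes> inv x}"
  then obtain y where y: "y \<in> generate G {h}" "w = x \<otimes> y \<otimes> inv x"
    unfolding generate_conjugate[OF x h] by blast
  have "y \<in> carrier G" using subgroup_generate[OF h] y(1) by (rule subgroup.mem_carrier)
  then show "inv x \<otimes> w \<otimes> x \<in> generate G {h}" using x y by (simp add: m_assoc)
next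
  assume *: "inv x \<otimes> w \<otimes> x \<in> generate G {h}"
  have "w = x \<otimes> (inv x \<otimes> w \<otimes> x) \<otimes> inv x" using x w by (simp add: m_assoc)
  with * show "w \<in> generate G {x \<otimes> h \<otimes> inv x}"
    unfolding generate_conjugate[OF x h] by blast
qed

lemma card_generate_conjugate:
  assumes x: "x \<in> carrier G" and h: "h \<in> carrier G"
  shows "card (generate G {x \<otimes> h \<otimes> inv x}) = card (generate G {h})"
  unfolding generate_conjugate[OF x h]
proof (rule card_image, rule inj_onI)
  fix y z assume "y \<in> generate G {h}" "z \<in> generate G {h}"
    and eq: "x \<otimes> y \<otimes> inv x = x \<otimes> z \<otimes> inv x"
  then have "y \<in> carrier G" "z \<in> carrier G"
    using subgroup.mem_carrier[OF subgroup_generate[OF h]] by auto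
  with eq x show "y = z" by simp
qed

text \<open>
  If \<open>x\<close> conjugated the generator \<open>h\<close> into \<open>\<langle>h\<rangle>\<close>, it would conjugate \<open>\<langle>h\<rangle>\<close> onto itself by
  finiteness, and then so would \<open>x\<^sup>-\<^sup>1\<close>. This makes the two overlap conditions in the same-type pairs
  consequences of the single hypothesis that the unit is non-trivial.
\<close>
lemma conjugate_notin_generate:
  assumes x: "x \<in> carrier G" and h: "h \<in> carrier G"
    and notin: "inv x \<otimes> h \<otimes> x \<notin> generate G {h}"
  shows "x \<otimes> h \<otimes> inv x \<notin> generate G {h}"
proof
  assume "x \<otimes> h \<otimes> inv x \<in> generate G {h}"
  then have "generate G {x \<otimes> h \<otimes> inv x} \<subseteq> generate G {h}"
    using subgroup_generate[OF h] by (intro generate_subgroup_incl) auto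
  moreover have "finite (generate G {h})"
    using subgroup.subset[OF subgroup_generate[OF h]] finite_carrier by (rule finite_subset)
  ultimately have "generate G {x \<otimes> h \<otimes> inv x} = generate G {h}"
    using card_generate_conjugate[OF x h] by (intro card_subset_eq) auto
  then have "h \<in> generate G {x \<otimes> h \<otimes> inv x}" using mem_generate_self by simp
  then show False using notin mem_generate_conjugate_iff[OF x h h] by simp
qed

text \<open>
  In this case the cosets \<open>xH\<close> and \<open>hxH\<close>, for \<open>H = \<langle>h\<rangle>\<close>, coincide and their indicators cancel.
\<close>
lemma beta_part_eq_zero:
  assumes x: "x \<in> carrier G" and h: "h \<in> carrier G" and l: "inv x \<otimes> h \<otimes> x \<in> generate G {h}"
  shows "beta_part x h = \<zero>\<^bsub>ZG\<^esub>"
proof (rule group_ring_eqI)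
  fix z assume z: "z \<in> carrier G"
  have "inv (inv x \<otimes> h \<otimes> x) \<in> generate G {h}"
    using subgroup_generate[OF h] l by (rule subgroup.m_inv_closed)
  from subgroup_mem_mult_iff(1)[OF subgroup_generate[OF h] this, of "inv x \<otimes> z"]
  show "beta_part x h z = \<zero>\<^bsub>ZG\<^esub> z"
    using x h z by (simp add: beta_part_apply inv_mult_group m_assoc)
qed (use x h in auto)

lemma gamma_part_eq_zero:
  assumes x: "x \<in> carrier G" and h: "h \<in> carrier G" and l: "x \<otimes> h \<otimes> inv x \<in> generate G {h}"
  shows "gamma_part x h = \<zero>\<^bsub>ZG\<^esub>"
proof (rule group_ring_eqI)
  fix z assume z: "z \<in> carrier G"
  have "inv (x \<otimes> h \<otimes> inv x) \<in> generate G {h}"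
    using subgroup_generate[OF h] l by (rule subgroup.m_inv_closed)
  from subgroup_mem_mult_iff(2)[OF subgroup_generate[OF h] this, of "z \<otimes> inv x"]
  show "gamma_part x h z = \<zero>\<^bsub>ZG\<^esub> z"
    using x h z by (simp add: gamma_part_apply inv_mult_group m_assoc)
qed (use x h in auto)

lemma sum_of_bool_coset:
  assumes K: "subgroup K G" and x: "x \<in> carrier G"
  shows "(\<Sum>g\<in>carrier G. of_bool (x \<otimes> g \<in> K)) = int (card K)"
    and "(\<Sum>g\<in>carrier G. of_bool (g \<otimes> x \<in> K)) = int (card K)"
proof -
  have "(\<Sum>g\<in>carrier G. of_bool (g \<in> K)) = (\<Sum>g\<in>K. 1 :: int)"
    using subgroup.subset[OF K] finite_carrier by (intro sum.mono_neutral_cong_right) auto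
  then show "(\<Sum>g\<in>carrier G. of_bool (x \<otimes> g \<in> K)) = int (card K)"
    "(\<Sum>g\<in>carrier G. of_bool (g \<otimes> x \<in> K)) = int (card K)"
    using sum_carrier_translate[OF x, of "\<lambda>g. of_bool (g \<in> K) :: int"] by simp_all
qed

lemma card_generate_ge_2:
  assumes h: "h \<in> carrier G" and "h \<noteq> \<one>"
  shows "2 \<le> card (generate G {h})"
proof -
  have "finite (generate G {h})"
    using subgroup.subset[OF subgroup_generate[OF h]] finite_carrier by (rule finite_subset)
  moreover have "{\<one>, h} \<subseteq> generate G {h}" using generate.one mem_generate_self by auto
  ultimately have "card {\<one>, h} \<le> card (generate G {h})" by (rule card_mono)
  with assms show ?thesis by simp
qed

text \<open>
  Where \<open>P\<close> holds, the product is \<open>1\<close>; elsewhere it is the product of two indicators, hence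
  non-negative.
\<close>
lemma overlap_bound:
  fixes P Q R :: "'i \<Rightarrow> bool"
  assumes "\<And>g. g \<in> A \<Longrightarrow> \<not> (P g \<and> Q g)" "\<And>g. g \<in> A \<Longrightarrow> \<not> (P g \<and> R g)"
  shows "(\<Sum>g\<in>A. of_bool (P g)) \<le> (\<Sum>g\<in>A. (of_bool (P g) - of_bool (Q g)) * (of_bool (P g) - of_bool (R g)) :: int)"
  using assms by (intro sum_mono) auto

text \<open>
  With \<open>H = \<langle>h\<rangle>\<close> and \<open>k = x h x\<^sup>-\<^sup>1\<close>, the predicates \<open>P\<close>, \<open>Q\<close>, \<open>R\<close> describe the cosets \<open>xH\<close>, \<open>hxH\<close> and
  \<open>xHk\<^sup>-\<^sup>1\<close>. The first is disjoint from the other two, so the product of the two square-zero parts has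
  coefficient at least \<open>\<bar>H\<bar>\<close> at \<open>1\<close>. The conjugate is chosen so that the second part, read at inverses,
  starts with the same coset \<open>xH\<close> as the first. It is right invariant under \<open>\<langle>k\<rangle>\<close>, which also has
  \<open>\<bar>H\<bar>\<close> elements and gives the second factor \<open>\<bar>H\<bar>\<close>.
\<close>
lemma free_pair_beta_beta:
  assumes x: "x \<in> carrier G" and h: "h \<in> carrier G"
    and notin: "inv x \<otimes> h \<otimes> x \<notin> generate G {h}"
  shows "free_pair (units_of ZG) (bicyclic_beta G x h) (bicyclic_beta G (inv x) (x \<otimes> h \<otimes> inv x))"
proof -
  define H where "H = generate G {h}"
  define k where "k = x \<otimes> h \<otimes> inv x"
  define P where "P g \<longleftrightarrow> inv x \<otimes> g \<in> H" for g
  define Q where "Q g \<longleftrightarrow> inv x \<otimes> (inv h \<otimes> g) \<in> H" for g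
  define R where "R g \<longleftrightarrow> inv x \<otimes> g \<otimes> k \<in> H" for g
  have k: "k \<in> carrier G" unfolding k_def using x h by simp
  have H: "subgroup H G" unfolding H_def by (rule subgroup_generate[OF h])
  have kH: "k \<notin> H" unfolding k_def H_def by (rule conjugate_notin_generate[OF x h notin])
  have "h \<noteq> \<one>" using notin x generate.one[of G "{h}"] by auto
  then have d: "2 \<le> card H" unfolding H_def by (rule card_generate_ge_2[OF h])
  have part: "beta_part x h g * beta_part (inv x) k (inv g)
      = (of_bool (P g) - of_bool (Q g)) * (of_bool (P g) - of_bool (R g))"
    if g: "g \<in> carrier G" for g
  proof -
    have "x \<otimes> inv g \<in> generate G {k} \<longleftrightarrow> P g"
      unfolding k_def P_def
      using mem_generate_conjugate_iff[OF x h, of "x \<otimes> inv g"] x g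
        subgroup_inv_mem_iff[OF H, of "inv x \<otimes> g"]
      by (simp add: m_assoc inv_mult_group H_def)
    moreover have "x \<otimes> (inv k \<otimes> inv g) \<in> generate G {k} \<longleftrightarrow> R g"
      using mem_generate_conjugate_iff[OF x h, of "x \<otimes> (inv k \<otimes> inv g)"] x g k
        subgroup_inv_mem_iff[OF H, of "inv x \<otimes> g \<otimes> k"]
      unfolding R_def by (simp add: m_assoc inv_mult_group H_def flip: k_def)
    ultimately show ?thesis
      using x h k g by (simp add: beta_part_apply P_def Q_def H_def)
  qed
  have "int (card H) = (\<Sum>g\<in>carrier G. of_bool (P g))"
    unfolding P_def using sum_of_bool_coset(1)[OF H, of "inv x"] x by simp
  also have "\<dots> \<le> (\<Sum>g\<in>carrier G.
      (of_bool (P g) - of_bool (Q g)) * (of_bool (P g) - of_bool (R g)))"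
  proof (rule overlap_bound)
    fix g assume g: "g \<in> carrier G"
    show "\<not> (P g \<and> Q g)"
    proof
      assume "P g \<and> Q g"
      then have "(inv x \<otimes> g) \<otimes> inv (inv x \<otimes> (inv h \<otimes> g)) \<in> H"
        unfolding P_def Q_def using H by (metis subgroup.m_closed subgroup.m_inv_closed)
      then show False using notin x h g by (simp add: m_assoc inv_mult_group H_def)
    qed
    show "\<not> (P g \<and> R g)"
      using subgroup_mem_mult_iff(1)[OF H _ k, of "inv x \<otimes> g"] kH unfolding P_def R_def by blast
  qed
  also have "\<dots> = (\<Sum>g\<in>carrier G. beta_part x h g * beta_part (inv x) k (inv g))"
    by (rule sum.cong[OF refl part, symmetric])
  finally have tr: "int (card H) \<le> (\<Sum>g\<in>carrier G. beta_part x h g * beta_part (inv x) k (inv g))" .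
  have "(2::int) * 2 \<le> int (card H) * (\<Sum>g\<in>carrier G. beta_part x h g * beta_part (inv x) k (inv g))"
    using d tr by (intro mult_mono) auto
  then have tr4: "4 \<le> int (card (generate G {k})) * (\<Sum>g\<in>carrier G. beta_part x h g * beta_part (inv x) k (inv g))"
    unfolding k_def card_generate_conjugate[OF x h] H_def by simp
  show ?thesis
    unfolding bicyclic_eq k_def[symmetric]
    using x h k tr4 part_square_zero part_invariant subgroup_generate[OF k]
    by (intro free_pair_if_large_trace[where K = "generate G {k}"]) auto
qed

text \<open>
  The mirror image of the previous argument, with right cosets. The invariance needed for the second
  factor \<open>\<bar>H\<bar>\<close> now comes from the first unit, whose square-zero part is left invariant under \<open>H\<close>.
\<close>
lemma free_pair_gamma_gamma:
  assumes x: "x \<in> carrier G" and h: "h \<in> carrier G"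
    and notin: "x \<otimes> h \<otimes> inv x \<notin> generate G {h}"
  shows "free_pair (units_of ZG) (bicyclic_gamma G x h) (bicyclic_gamma G (inv x) (inv x \<otimes> h \<otimes> x))"
proof -
  define H where "H = generate G {h}"
  define k where "k = inv x \<otimes> h \<otimes> x"
  define P where "P g \<longleftrightarrow> g \<otimes> inv x \<in> H" for g
  define Q where "Q g \<longleftrightarrow> g \<otimes> inv h \<otimes> inv x \<in> H" for g
  define R where "R g \<longleftrightarrow> k \<otimes> (g \<otimes> inv x) \<in> H" for g
  have k: "k \<in> carrier G" unfolding k_def using x h by simp
  have H: "subgroup H G" unfolding H_def by (rule subgroup_generate[OF h])
  have kH: "k \<notin> H"
    using conjugate_notin_generate[of "inv x" h] notin x h unfolding k_def H_def by simp
  have "h \<noteq> \<one>" using notin x generate.one[of G "{h}"] by auto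
  then have d: "2 \<le> card H" unfolding H_def by (rule card_generate_ge_2[OF h])
  have memK: "w \<in> generate G {k} \<longleftrightarrow> x \<otimes> w \<otimes> inv x \<in> H" if "w \<in> carrier G" for w
    using mem_generate_conjugate_iff[of "inv x" h w] x h that unfolding k_def H_def by simp
  have part: "gamma_part x h g * gamma_part (inv x) k (inv g)
      = (of_bool (P g) - of_bool (Q g)) * (of_bool (P g) - of_bool (R g))"
    if g: "g \<in> carrier G" for g
  proof -
    have "inv g \<otimes> x \<in> generate G {k} \<longleftrightarrow> P g"
      unfolding P_def using x g subgroup_inv_mem_iff[OF H, of "g \<otimes> inv x"]
      by (simp add: m_assoc inv_mult_group memK)
    moreover have "inv g \<otimes> inv k \<otimes> x \<in> generate G {k} \<longleftrightarrow> R g"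
      unfolding R_def using x g k subgroup_inv_mem_iff[OF H, of "k \<otimes> (g \<otimes> inv x)"]
      by (simp add: m_assoc inv_mult_group memK)
    ultimately show ?thesis
      using x h k g by (simp add: gamma_part_apply P_def Q_def H_def)
  qed
  have "int (card H) = (\<Sum>g\<in>carrier G. of_bool (P g))"
    unfolding P_def using sum_of_bool_coset(2)[OF H, of "inv x"] x by simp
  also have "\<dots> \<le> (\<Sum>g\<in>carrier G.
      (of_bool (P g) - of_bool (Q g)) * (of_bool (P g) - of_bool (R g)))"
  proof (rule overlap_bound)
    fix g assume g: "g \<in> carrier G"
    show "\<not> (P g \<and> Q g)"
    proof
      assume "P g \<and> Q g"
      then have "inv (g \<otimes> inv h \<otimes> inv x) \<otimes> (g \<otimes> inv x) \<in> H"
        unfolding P_def Q_def using H by (metis subgroup.m_closed subgroup.m_inv_closed)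
      then show False using notin x h g by (simp add: m_assoc inv_mult_group H_def)
    qed
    show "\<not> (P g \<and> R g)"
      using subgroup_mem_mult_iff(2)[OF H _ k, of "g \<otimes> inv x"] kH unfolding P_def R_def by blast
  qed
  also have "\<dots> = (\<Sum>g\<in>carrier G. gamma_part x h g * gamma_part (inv x) k (inv g))"
    by (rule sum.cong[OF refl part, symmetric])
  finally have tr: "int (card H) \<le> (\<Sum>g\<in>carrier G. gamma_part x h g * gamma_part (inv x) k (inv g))" .
  have "(2::int) * 2 \<le> int (card H) * (\<Sum>g\<in>carrier G. gamma_part x h g * gamma_part (inv x) k (inv g))"
    using d tr by (intro mult_mono) auto
  then show ?thesis
    unfolding bicyclic_eq k_def[symmetric]
    using x h k part_square_zero part_invariant H
    by (intro free_pair_if_large_trace[where K = H]) (auto simp: H_def)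
qed

lemma generate_inverse:
  assumes h: "h \<in> carrier G"
  shows "generate G {inv h} = generate G {h}"
proof
  have "generate G {inv g} \<subseteq> generate G {g}" if "g \<in> carrier G" for g
    using subgroup.m_inv_closed[OF subgroup_generate mem_generate_self] that
    by (intro generate_subgroup_incl subgroup_generate) auto
  from this[OF h] this[of "inv h"] h
  show "generate G {inv h} \<subseteq> generate G {h}" "generate G {h} \<subseteq> generate G {inv h}" by simp_all
qed

text \<open>
  The second unit is the image of the first under the involution \<open>g \<mapsto> g\<^sup>-\<^sup>1\<close>, so the coefficient at
  \<open>1\<close> is the sum of the squares of the values of the first square-zero part. These are \<open>1\<close> on one
  coset of \<open>\<langle>h\<rangle>\<close>, \<open>-1\<close> on another and \<open>0\<close> elsewhere, which already gives at least \<open>4\<close> with \<open>K\<close> trivial.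
\<close>
lemma free_pair_beta_gamma:
  assumes x: "x \<in> carrier G" and h: "h \<in> carrier G"
    and notin: "inv x \<otimes> h \<otimes> x \<notin> generate G {h}"
  shows "free_pair (units_of ZG) (bicyclic_beta G x h) (bicyclic_gamma G (inv x) (inv h))"
proof -
  define H where "H = generate G {h}"
  define P where "P g \<longleftrightarrow> inv x \<otimes> g \<in> H" for g
  define Q where "Q g \<longleftrightarrow> inv x \<otimes> (inv h \<otimes> g) \<in> H" for g
  have H: "subgroup H G" unfolding H_def by (rule subgroup_generate[OF h])
  have "h \<noteq> \<one>" using notin x generate.one[of G "{h}"] by auto
  then have d: "2 \<le> card H" unfolding H_def by (rule card_generate_ge_2[OF h])
  have H_inv: "generate G {inv h} = H" unfolding H_def by (rule generate_inverse[OF h])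
  have part: "beta_part x h g * gamma_part (inv x) (inv h) (inv g) = of_bool (P g) + of_bool (Q g)"
    if g: "g \<in> carrier G" for g
  proof -
    have "inv g \<otimes> x \<in> H \<longleftrightarrow> P g"
      unfolding P_def using x g subgroup_inv_mem_iff[OF H, of "inv x \<otimes> g"]
      by (simp add: inv_mult_group)
    moreover have "inv g \<otimes> h \<otimes> x \<in> H \<longleftrightarrow> Q g"
      unfolding Q_def using x g h subgroup_inv_mem_iff[OF H, of "inv x \<otimes> (inv h \<otimes> g)"]
      by (simp add: inv_mult_group m_assoc)
    moreover have "\<not> (P g \<and> Q g)"
    proof
      assume "P g \<and> Q g"
      then have "(inv x \<otimes> g) \<otimes> inv (inv x \<otimes> (inv h \<otimes> g)) \<in> H"
        unfolding P_def Q_def using H by (metis subgroup.m_closed subgroup.m_inv_closed)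
      then show False using notin x h g by (simp add: m_assoc inv_mult_group H_def)
    qed
    ultimately show ?thesis
      using x h g
      by (simp add: beta_part_apply gamma_part_apply H_inv) (auto simp: P_def Q_def H_def)
  qed
  have "(\<Sum>g\<in>carrier G. beta_part x h g * gamma_part (inv x) (inv h) (inv g))
      = (\<Sum>g\<in>carrier G. of_bool (P g)) + (\<Sum>g\<in>carrier G. of_bool (Q g))"
    using part by (simp add: sum.distrib)
  also have "(\<Sum>g\<in>carrier G. of_bool (P g)) = int (card H)"
    unfolding P_def using sum_of_bool_coset(1)[OF H, of "inv x"] x by simp
  also have "(\<Sum>g\<in>carrier G. of_bool (Q g)) = int (card H)"
    unfolding Q_def using sum_of_bool_coset(1)[OF H, of "inv x \<otimes> inv h"] x h by (simp add: m_assoc)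
  finally have tr: "4 \<le> int (card {\<one>})
      * (\<Sum>g\<in>carrier G. beta_part x h g * gamma_part (inv x) (inv h) (inv g))"
    using d by simp
  have "right_invariant {\<one>} (gamma_part (inv x) (inv h))" by (simp add: right_invariant_def)
  then show ?thesis
    unfolding bicyclic_eq
    using x h part_square_zero tr triv_subgroup
    by (intro free_pair_if_large_trace[where K = "{\<one>}"]) auto
qed

text \<open>
  A unit of type \<open>\<gamma>\<close> is paired with its image under the involution by exchanging the roles of the two
  units in \<open>free_pair_beta_gamma\<close>.
\<close>
lemma bicyclic_unit_has_free_partners:
  assumes "\<alpha> \<in> bicyclic_units G" and "\<alpha> \<noteq> \<one>\<^bsub>ZG\<^esub>"
  obtains \<beta> \<gamma> where "\<beta> \<in> beta_units G" and "\<gamma> \<in> gamma_units G"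
    and "free_pair (units_of ZG) \<alpha> \<beta>" and "free_pair (units_of ZG) \<alpha> \<gamma>"
proof -
  from assms(1) consider "\<alpha> \<in> beta_units G" | "\<alpha> \<in> gamma_units G"
    by (auto simp: bicyclic_units_def)
  then show ?thesis
  proof cases
    case 1
    then obtain x h where x: "x \<in> carrier G" and h: "h \<in> carrier G" and \<alpha>: "\<alpha> = bicyclic_beta G x h"
      by (auto simp: beta_units_def)
    have notin: "inv x \<otimes> h \<otimes> x \<notin> generate G {h}"
      using assms(2) beta_part_eq_zero[OF x h] unfolding \<alpha> bicyclic_eq by auto
    show ?thesis
    proof (rule that)
      show "bicyclic_beta G (inv x) (x \<otimes> h \<otimes> inv x) \<in> beta_units G"
        "bicyclic_gamma G (inv x) (inv h) \<in> gamma_units G"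
        unfolding beta_units_def gamma_units_def using x h by blast+
    qed (simp_all add: \<alpha> free_pair_beta_beta[OF x h notin] free_pair_beta_gamma[OF x h notin])
  next
    case 2
    then obtain x h where x: "x \<in> carrier G" and h: "h \<in> carrier G" and \<alpha>: "\<alpha> = bicyclic_gamma G x h"
      by (auto simp: gamma_units_def)
    have notin: "x \<otimes> h \<otimes> inv x \<notin> generate G {h}"
      using assms(2) gamma_part_eq_zero[OF x h] unfolding \<alpha> bicyclic_eq by auto
    have "inv (inv x) \<otimes> inv h \<otimes> inv x \<notin> generate G {inv h}"
      unfolding generate_inverse[OF h]
      using notin subgroup_inv_mem_iff[OF subgroup_generate[OF h], of "x \<otimes> h \<otimes> inv x"] x h
      by (simp add: inv_mult_group m_assoc)
    from free_pair_beta_gamma[OF _ _ this]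
    have free: "free_pair (units_of ZG) \<alpha> (bicyclic_beta G (inv x) (inv h))"
      unfolding \<alpha> using x h by (simp add: free_pair_commute)
    show ?thesis
    proof (rule that)
      show "bicyclic_beta G (inv x) (inv h) \<in> beta_units G"
        "bicyclic_gamma G (inv x) (inv x \<otimes> h \<otimes> x) \<in> gamma_units G"
        unfolding beta_units_def gamma_units_def using x h by blast+
    qed (use free in \<open>simp_all add: \<alpha> free_pair_gamma_gamma[OF x h notin]\<close>)
  qed
qed

end

theorem theorem1p2:
  fixes G :: "('a, 'b) monoid_scheme"
  assumes "group G" and "finite (carrier G)"
    and "\<alpha> \<in> bicyclic_units G" and "\<alpha> \<noteq> \<one>\<^bsub>group_ring G\<^esub>"
  shows "\<exists>\<beta> \<in> bicyclic_units G. \<exists>\<gamma> \<in> bicyclic_units G.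
    different_types G \<beta> \<gamma> \<and>
    free_pair (units_of (group_ring G)) \<alpha> \<beta> \<and>
    free_pair (units_of (group_ring G)) \<alpha> \<gamma>"
proof -
  interpret finite_group G
    using assms(1,2) by (simp add: finite_group_def finite_group_axioms_def)
  obtain \<beta> \<gamma> where "\<beta> \<in> beta_units G" "\<gamma> \<in> gamma_units G"
    "free_pair (units_of (group_ring G)) \<alpha> \<beta>" "free_pair (units_of (group_ring G)) \<alpha> \<gamma>"
    using bicyclic_unit_has_free_partners[OF assms(3,4)] by blast
  then show ?thesis
    by (auto simp: bicyclic_units_def different_types_def)
qed

end
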